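(* Let $\mathcal G=(V,E)$, $V=\{1,\dots,d\}$, be a decomposable and connected graph with cliques $\mathcal C$ and separators $\mathcal D$, and suppose that $\{\lambda_I: I\in\mathcal C\cup\mathcal D\}$ is a set of valid, positive and continuous exponent measure densities. For all $D\in\mathcal D$, $C\in\mathcal C$ with $D\subset C$, assume the consistency constraint $$\lambda_D(\boldsymbol y_D)=\int_{[0,\infty)^{|C\setminus D|}}\lambda_C(\boldsymbol y_C)\,\mathrm d\boldsymbol y_{C\setminus D}.$$ Then the density of a valid $d$-dimensional exponent measure $\Lambda$ is given by $$\lambda(\boldsymbol y)=\frac{\prod_{C\in\mathcal C}\lambda_C(\boldsymbol y_C)}{\prod_{D\in\mathcal D}\lambda_D(\boldsymbol y_D)},\qquad\boldsymbol y\in\mathcal L,$$ and the function $f_{\boldsymbol Y}(\boldsymbol y)=\lambda(\boldsymbol y)/\Lambda(\boldsymbol 1)$, $\boldsymbol y\in\mathcal L$, is the density of a multivariate Pareto distribution satisfying the pairwise Markov property relative to $\mathcal G$.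
   Context: Setting. $V=\{1,\dots,d\}$, $d\ge2$; $\mathcal E=[0,\infty)^d\setminus\{\boldsymbol 0\}$; $\mathcal L=\{\boldsymbol x\in\mathcal E:\|\boldsymbol x\|_\infty>1\}$. For $I\subset V$, $\boldsymbol x_I=(x_i)_{i\in I}$. Valid exponent measure density on an index set $I$ (non-empty): a function $\lambda_I$ of $\boldsymbol y_I\in[0,\infty)^{|I|}\setminus\{\boldsymbol 0\}$ satisfying (L1) $\lambda_I(t\boldsymbol y_I)=t^{-(|I|+1)}\lambda_I(\boldsymbol y_I)$ for $t>0$, and (L2) $\int_{\{y_i>1\}}\lambda_I(\boldsymbol y_I)\,\mathrm d\boldsymbol y_I=1$ for each $i\in I$. For $|I|=1$ this forces $\lambda_{\{i\}}(y_i)=y_i^{-2}$. Positivity, continuity and pointwise identities are understood at points with strictly positive coordinates (faces have zero mass). The $d$-dimensional exponent measure $\Lambda$ is the measure on $\mathcal E$ with density $\lambda$ (given by the same formula, equivalently extended from $\mathcal L$ by homogeneity), and $\Lambda(\boldsymbol 1)=\Lambda(\mathcal E\setminus[\boldsymbol 0,\boldsymbol 1])=\int_{\mathcal L}\lambda(\boldsymbol y)\,\mathrm d\boldsymbol y$. Multivariate Pareto distribution: the distribution on $\mathcal L$ with density $\lambda/\Lambda(\boldsymbol 1)$ for a valid exponent measure density $\lambda$ on $V$. For $\boldsymbol Y$ multivariate Pareto and $k\in V$, $\boldsymbol Y^k$ is $\boldsymbol Y$ conditioned on $\{Y_k>1\}$. For disjoint non-empty $A,B,C$ with union $V$, $\boldsymbol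 Y_A\perp_e\boldsymbol Y_C\mid\boldsymbol Y_B$ means that for every $k\in V$, $\boldsymbol Y_A^k$ and $\boldsymbol Y_C^k$ are conditionally independent given $\boldsymbol Y_B^k$ in the usual sense. Pairwise Markov property relative to $\mathcal G$: $Y_i\perp_e Y_j\mid\boldsymbol Y_{\setminus\{i,j\}}$ for all distinct $i,j$ with $(i,j)\notin E$. Graphs: undirected; cliques are maximal complete subsets. Decomposable means chordal. For a connected decomposable graph the cliques can be ordered $C_1,\dots,C_m$ so that for $i=2,\dots,m$, $D_i:=C_i\cap\bigcup_{j<i}C_j\subset C_l$ for some $l<i$ (running intersection property); $\mathcal C=\{C_1,\dots,C_m\}$ and $\mathcal D$ is the multiset $\{D_2,\dots,D_m\}$ of separators, which are non-empty. *)

theory Defs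
  imports "HOL-Probability.Probability"
begin

section \<open>Graphs\<close>

text \<open>
  A finite simple graph on \<open>V\<close> is given by its symmetric irreflexive adjacency relation \<open>E\<close>.
\<close>

definition simple_graph :: "'v set \<Rightarrow> ('v \<times> 'v) set \<Rightarrow> bool" where
  "simple_graph V E \<longleftrightarrow> finite V \<and> E \<subseteq> V \<times> V \<and> sym E \<and> irrefl E"

definition connected_graph :: "'v set \<Rightarrow> ('v \<times> 'v) set \<Rightarrow> bool" where
  "connected_graph V E \<longleftrightarrow> (\<forall>u\<in>V. \<forall>v\<in>V. (u, v) \<in> E\<^sup>*)"

definition is_cycle :: "('v \<times> 'v) set \<Rightarrow> 'v list \<Rightarrow> bool" where
  "is_cycle E c \<longleftrightarrow> 3 \<le> length c \<and> distinct c \<and>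
     (\<forall>i<length c. (c ! i, c ! (Suc i mod length c)) \<in> E)"

definition has_chord :: "('v \<times> 'v) set \<Rightarrow> 'v list \<Rightarrow> bool" where
  "has_chord E c \<longleftrightarrow> (\<exists>i<length c. \<exists>j<length c.
     j \<noteq> Suc i mod length c \<and> i \<noteq> Suc j mod length c \<and> (c ! i, c ! j) \<in> E)"

definition chordal :: "('v \<times> 'v) set \<Rightarrow> bool" where
  "chordal E \<longleftrightarrow> (\<forall>c. is_cycle E c \<and> 4 \<le> length c \<longrightarrow> has_chord E c)"

definition complete_subset :: "'v set \<Rightarrow> ('v \<times> 'v) set \<Rightarrow> 'v set \<Rightarrow> bool" where
  "complete_subset V E S \<longleftrightarrow> S \<subseteq> V \<and> (\<forall>u\<in>S. \<forall>v\<in>S. u \<noteq> v \<longrightarrow> (u, v) \<in> E)"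

definition cliques :: "'v set \<Rightarrow> ('v \<times> 'v) set \<Rightarrow> 'v set set" where
  "cliques V E = {S. complete_subset V E S \<and> (\<forall>T. complete_subset V E T \<and> S \<subseteq> T \<longrightarrow> T = S)}"

text \<open>
  List positions start at 0, so the separators sit at the positions \<open>1, \<dots>, length Cs - 1\<close>.
\<close>

definition separator_at :: "'v set list \<Rightarrow> nat \<Rightarrow> 'v set" where
  "separator_at Cs i = Cs ! i \<inter> (\<Union>j<i. Cs ! j)"

definition running_intersection :: "'v set list \<Rightarrow> bool" where
  "running_intersection Cs \<longleftrightarrow>
     (\<forall>i. 1 \<le> i \<and> i < length Cs \<longrightarrow> (\<exists>l<i. separator_at Cs i \<subseteq> Cs ! l))"

definition clique_ordering :: "'v set \<Rightarrow> ('v \<times> 'v) set \<Rightarrow> 'v set list \<Rightarrow> bool" where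
  "clique_ordering V E Cs \<longleftrightarrow>
     distinct Cs \<and> set Cs = cliques V E \<and> running_intersection Cs"

definition separators :: "'v set list \<Rightarrow> 'v set multiset" where
  "separators Cs = mset (map (separator_at Cs) [1..<length Cs])"


section \<open>Exponent measures\<close>

text \<open>
  A vector indexed by a finite set \<open>I\<close> is a function that is extensional on \<open>I\<close>, i.e. a point of
  the product measure space \<open>leb I\<close>; the subvector on \<open>J\<close> is \<open>restrict x J\<close>.
\<close>

definition leb :: "'v set \<Rightarrow> ('v \<Rightarrow> real) measure" where
  "leb I = (\<Pi>\<^sub>M i\<in>I. lborel)"

definition nonneg_orthant :: "'v set \<Rightarrow> ('v \<Rightarrow> real) set" where
  "nonneg_orthant I = (\<Pi>\<^sub>E i\<in>I. {0..})"

definition pos_orthant :: "'v set \<Rightarrow> ('v \<Rightarrow> real) set" where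
  "pos_orthant I = (\<Pi>\<^sub>E i\<in>I. {0<..})"

definition punctured_orthant :: "'v set \<Rightarrow> ('v \<Rightarrow> real) set" where
  "punctured_orthant I = nonneg_orthant I - {\<lambda>i\<in>I. 0}"

definition pareto_space :: "'v set \<Rightarrow> ('v \<Rightarrow> real) set" where
  "pareto_space I = {x \<in> punctured_orthant I. Max ((\<lambda>i. \<bar>x i\<bar>) ` I) > 1}"

text \<open>
  Only the strictly positive points are constrained pointwise: the faces of the orthant are null
  sets, and a restriction of a non-zero vector may lie on a face or even vanish.
\<close>

definition valid_exponent_density :: "'v set \<Rightarrow> (('v \<Rightarrow> real) \<Rightarrow> real) \<Rightarrow> bool" where
  "valid_exponent_density I f \<longleftrightarrow>
     finite I \<and> I \<noteq> {} \<and>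
     f \<in> borel_measurable (restrict_space (leb I) (punctured_orthant I)) \<and>
     (\<forall>y\<in>pos_orthant I. 0 \<le> f y) \<and>
     (\<forall>y\<in>pos_orthant I. \<forall>t>0. f (\<lambda>i\<in>I. t * y i) = f y / t ^ (card I + 1)) \<and>
     (\<forall>i\<in>I. (\<integral>\<^sup>+ y \<in> {y \<in> punctured_orthant I. y i > 1}. ennreal (f y) \<partial>leb I) = 1)"

definition positive_density :: "'v set \<Rightarrow> (('v \<Rightarrow> real) \<Rightarrow> real) \<Rightarrow> bool" where
  "positive_density I f \<longleftrightarrow> (\<forall>y\<in>pos_orthant I. 0 < f y)"

text \<open>
  Continuity refers to the product topology on functions, which on \<open>pos_orthant I\<close> is the Euclidean
  topology when \<open>I\<close> is finite.
\<close>

definition continuous_density :: "'v set \<Rightarrow> (('v \<Rightarrow> real) \<Rightarrow> real) \<Rightarrow> bool" where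
  "continuous_density I f \<longleftrightarrow> continuous_on (pos_orthant I) f"

text \<open>\<open>g\<close> is the marginal of \<open>f\<close> on \<open>D \<subseteq> C\<close>.\<close>

definition is_marginal_density ::
    "'v set \<Rightarrow> 'v set \<Rightarrow> (('v \<Rightarrow> real) \<Rightarrow> real) \<Rightarrow> (('v \<Rightarrow> real) \<Rightarrow> real) \<Rightarrow> bool" where
  "is_marginal_density D C g f \<longleftrightarrow> (\<forall>y\<in>pos_orthant D.
     ennreal (g y) =
       (\<integral>\<^sup>+ z \<in> nonneg_orthant (C - D). ennreal (f (merge D (C - D) (y, z))) \<partial>leb (C - D)))"

definition exponent_measure :: "'v set \<Rightarrow> (('v \<Rightarrow> real) \<Rightarrow> real) \<Rightarrow> ('v \<Rightarrow> real) measure" where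
  "exponent_measure I f =
     density (restrict_space (leb I) (punctured_orthant I)) (\<lambda>y. ennreal (f y))"

text \<open>The mass of the complement of the unit cube, usually written \<open>\<Lambda>(1)\<close>.\<close>

definition exponent_mass :: "'v set \<Rightarrow> (('v \<Rightarrow> real) \<Rightarrow> real) \<Rightarrow> real" where
  "exponent_mass I f =
     measure (exponent_measure I f) (punctured_orthant I - (\<Pi>\<^sub>E i\<in>I. {0..1}))"

definition law_with_density :: "'v set \<Rightarrow> (('v \<Rightarrow> real) \<Rightarrow> real) \<Rightarrow> ('v \<Rightarrow> real) measure" where
  "law_with_density I g =
     density (restrict_space (leb I) (pareto_space I)) (\<lambda>y. ennreal (g y))"

text \<open>
  The requirement \<open>prob_space\<close> says that the normalisation is the right one; in particular the
  mass of the complement of the unit cube is positive and finite.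
\<close>

definition multivariate_pareto :: "'v set \<Rightarrow> ('v \<Rightarrow> real) measure \<Rightarrow> bool" where
  "multivariate_pareto I P \<longleftrightarrow> prob_space P \<and>
     (\<exists>f. valid_exponent_density I f \<and>
          P = law_with_density I (\<lambda>y. f y / exponent_mass I f))"


section \<open>Conditional independence\<close>

definition cond_indep_var ::
    "'a measure \<Rightarrow> 'b measure \<Rightarrow> ('a \<Rightarrow> 'b) \<Rightarrow> 'c measure \<Rightarrow> ('a \<Rightarrow> 'c)
      \<Rightarrow> 'd measure \<Rightarrow> ('a \<Rightarrow> 'd) \<Rightarrow> bool" where
  "cond_indep_var M S X T Y U Z \<longleftrightarrow>
     X \<in> measurable M S \<and> Y \<in> measurable M T \<and> Z \<in> measurable M U \<and>
     (\<forall>A\<in>sets S. \<forall>B\<in>sets T. AE \<omega> in M.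
        real_cond_exp M (vimage_algebra (space M) Z U)
            (\<lambda>\<omega>. indicator A (X \<omega>) * indicator B (Y \<omega>)) \<omega> =
        real_cond_exp M (vimage_algebra (space M) Z U) (\<lambda>\<omega>. indicator A (X \<omega>)) \<omega> *
        real_cond_exp M (vimage_algebra (space M) Z U) (\<lambda>\<omega>. indicator B (Y \<omega>)) \<omega>)"

text \<open>
  \<open>P\<close> is the law of a random vector \<open>Y\<close> indexed by \<open>V\<close>, and \<open>uniform_measure\<close> conditions it on
  \<open>Y k > 1\<close>. The notion is meant for disjoint non-empty \<open>A\<close>, \<open>B\<close>, \<open>C\<close> with union \<open>V\<close>.
\<close>

definition extremal_cond_indep ::
    "'v set \<Rightarrow> ('v \<Rightarrow> real) measure \<Rightarrow> 'v set \<Rightarrow> 'v set \<Rightarrow> 'v set \<Rightarrow> bool" where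
  "extremal_cond_indep V P A C B \<longleftrightarrow> (\<forall>k\<in>V.
     cond_indep_var (uniform_measure P {y \<in> space P. y k > 1})
       (\<Pi>\<^sub>M i\<in>A. borel) (\<lambda>y. restrict y A)
       (\<Pi>\<^sub>M i\<in>C. borel) (\<lambda>y. restrict y C)
       (\<Pi>\<^sub>M i\<in>B. borel) (\<lambda>y. restrict y B))"

definition pairwise_markov :: "'v set \<Rightarrow> ('v \<times> 'v) set \<Rightarrow> ('v \<Rightarrow> real) measure \<Rightarrow> bool" where
  "pairwise_markov V E P \<longleftrightarrow> (\<forall>i\<in>V. \<forall>j\<in>V. i \<noteq> j \<and> (i, j) \<notin> E \<longrightarrow>
     extremal_cond_indep V P {i} {j} (V - {i, j}))"


section \<open>Clique factorisation\<close>

definition clique_density ::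
    "'v set set \<Rightarrow> 'v set multiset \<Rightarrow> ('v set \<Rightarrow> ('v \<Rightarrow> real) \<Rightarrow> real) \<Rightarrow> ('v \<Rightarrow> real) \<Rightarrow> real" where
  "clique_density \<C> \<D> lam y =
     (\<Prod>C\<in>\<C>. lam C (restrict y C)) / (\<Prod>D\<in>#\<D>. lam D (restrict y D))"

end

theory Submission
  imports Defs
begin

text \<open>
  Along a clique ordering with the running intersection property, appending \<open>C\<^sub>n\<close> multiplies the
  density by the kernel \<open>\<lambda>\<^sub>C / \<lambda>\<^sub>D\<close>, which integrates to one over the new coordinates by consistency.
  Hence the marginals on the earlier cliques are unchanged. The new clique gets the marginal \<open>\<lambda>\<^sub>C\<close>,
  because \<open>D\<close> lies in an earlier clique, so that the previous marginal on \<open>D\<close> is already \<open>\<lambda>\<^sub>D\<close>. Therefore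
  the joint density has marginal \<open>\<lambda>\<^sub>C\<close> on every clique, and its normalisation at coordinate \<open>i\<close> can be
  read off any clique containing \<open>i\<close>. Homogeneity is the count
  \<open>\<Sum> (|C| + 1) - \<Sum> (|D| + 1) = |V| + 1\<close>. If \<open>i\<close> and \<open>j\<close> are not adjacent, no clique contains both,
  so the density of \<open>Y\<close> given \<open>Y\<^sub>k > 1\<close> is a product of a function free of \<open>y\<^sub>j\<close> and one free of \<open>y\<^sub>i\<close>.
\<close>

section \<open>Lebesgue measure on finite products\<close>

interpretation lborel_product: product_sigma_finite "\<lambda>_::'v. lborel :: real measure"
  by unfold_locales

lemma space_leb: "space (leb I) = (\<Pi>\<^sub>E i\<in>I. UNIV)"
  by (simp add: leb_def space_PiM)

text \<open>Conditional independence is formulated with products of \<open>borel\<close>, while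
  densities are integrated against products of \<open>lborel\<close>. This equality lets
  measurability pass between the two.\<close>

lemma sets_leb: "sets (leb I) = sets (\<Pi>\<^sub>M i\<in>I. borel)"
  unfolding leb_def by (rule sets_PiM_cong) auto

lemma measurable_leb_component [measurable (raw)]: "i \<in> I \<Longrightarrow> (\<lambda>y. y i) \<in> borel_measurable (leb I)"
  unfolding leb_def by simp

lemma measurable_leb_restrict: "J \<subseteq> I \<Longrightarrow> (\<lambda>y. restrict y J) \<in> measurable (leb I) (leb J)"
  unfolding leb_def by (rule measurable_restrict_subset)

lemma measurable_leb_restrict_comp:
  "J \<subseteq> I \<Longrightarrow> f \<in> measurable (leb J) N \<Longrightarrow> (\<lambda>y. f (restrict y J)) \<in> measurable (leb I) N"
  by (rule measurable_compose[OF measurable_leb_restrict])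

lemma measurable_leb_merge:
  "merge I J \<in> measurable (leb I \<Otimes>\<^sub>M leb J) (leb (I \<union> J))"
  unfolding leb_def by (rule measurable_merge)

lemma sets_leb_PiE [measurable]:
  "finite I \<Longrightarrow> (\<And>i. i \<in> I \<Longrightarrow> A i \<in> sets borel) \<Longrightarrow> (\<Pi>\<^sub>E i\<in>I. A i) \<in> sets (leb I)"
  unfolding leb_def by (rule sets_PiM_I_finite) auto

lemma sigma_finite_leb: "finite I \<Longrightarrow> sigma_finite_measure (leb I)"
  unfolding leb_def by (rule lborel_product.sigma_finite)

lemma nn_integral_leb_fold:
  assumes "I \<inter> J = {}" "finite I" "finite J" "f \<in> borel_measurable (leb (I \<union> J))"
  shows "integral\<^sup>N (leb (I \<union> J)) f = (\<integral>\<^sup>+x. \<integral>\<^sup>+z. f (merge I J (x, z)) \<partial>leb J \<partial>leb I)"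
  using assms unfolding leb_def by (rule lborel_product.product_nn_integral_fold)

lemma nn_integral_leb_insert:
  assumes "finite I" "i \<notin> I" "f \<in> borel_measurable (leb (insert i I))"
  shows "integral\<^sup>N (leb (insert i I)) f = (\<integral>\<^sup>+x. \<integral>\<^sup>+s. f (x(i := s)) \<partial>lborel \<partial>leb I)"
  using assms unfolding leb_def by (rule lborel_product.product_nn_integral_insert)

lemma AE_leb_component_nonzero:
  assumes "finite I" "i \<in> I"
  shows "AE y in leb I. y i \<noteq> 0"
proof -
  let ?N = "\<Pi>\<^sub>E j\<in>I. (if j = i then {0} else UNIV :: real set)"
  have "emeasure (leb I) ?N = (\<Prod>j\<in>I. emeasure lborel (if j = i then {0} else UNIV :: real set))"
    unfolding leb_def by (rule lborel_product.emeasure_PiM[OF assms(1)]) auto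
  also have "\<dots> = 0"
    using assms by (auto intro!: bexI[of _ i])
  finally have "?N \<in> null_sets (leb I)"
    using assms by auto
  then show ?thesis
    by (rule AE_I') (auto simp: space_leb PiE_iff extensional_def)
qed

text \<open>The faces of the orthant are null sets. This is what allows assumptions made only at
  strictly positive points to determine integrals over the closed orthant.\<close>

lemma AE_leb_nonneg_pos:
  assumes "finite I"
  shows "AE y in leb I. y \<in> nonneg_orthant I \<longrightarrow> y \<in> pos_orthant I"
proof -
  have "AE y in leb I. \<forall>i\<in>I. y i \<noteq> 0"
    by (rule AE_finite_allI[OF assms]) (rule AE_leb_component_nonzero[OF assms])
  then show ?thesis
    by eventually_elim (auto simp: nonneg_orthant_def pos_orthant_def PiE_iff less_le)
qed

lemma measurable_leb_fun_upd2:
  "(\<lambda>(b, s, t). b(i := s, j := t)) \<in> measurable (leb I \<Otimes>\<^sub>M borel \<Otimes>\<^sub>M borel) (leb (insert j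
      (insert i I)))"
proof -
  have "(\<lambda>(b, s, t). b(i := s, j := t)) \<in> measurable (leb I \<Otimes>\<^sub>M lborel \<Otimes>\<^sub>M lborel) (leb (insert j
      (insert i I)))"
    unfolding leb_def by measurable
  moreover have "sets (leb I \<Otimes>\<^sub>M lborel \<Otimes>\<^sub>M lborel)
      = sets (leb I \<Otimes>\<^sub>M borel \<Otimes>\<^sub>M (borel :: real measure))"
    by (intro sets_pair_measure_cong) auto
  ultimately show ?thesis using measurable_cong_sets by blast
qed

text \<open>The coordinates \<open>i\<close> and \<open>j\<close> are integrated innermost, so that
  the outer variable \<open>b\<close> is the vector on which one conditions.\<close>

lemma nn_integral_leb_two:
  assumes "finite V" "i \<in> V" "j \<in> V" "i \<noteq> j" "f \<in> borel_measurable (leb V)"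
  shows "integral\<^sup>N (leb V) f
    = (\<integral>\<^sup>+b. \<integral>\<^sup>+s. \<integral>\<^sup>+t. f (b(i := s, j := t)) \<partial>lborel \<partial>lborel \<partial>leb (V - {i, j}))"
proof -
  let ?B = "V - {i, j}"
  have V: "V = insert j (insert i ?B)" using assms by auto
  have f: "f \<in> borel_measurable (leb (insert j (insert i ?B)))" using assms V by simp
  have g: "(\<lambda>x. \<integral>\<^sup>+t. f (x(j := t)) \<partial>lborel) \<in> borel_measurable (leb (insert i ?B))"
  proof -
    have "(\<lambda>(x, t). x(j := t)) \<in> measurable (leb (insert i ?B) \<Otimes>\<^sub>M lborel) (leb (insert j
        (insert i ?B)))"
      unfolding leb_def by measurable
    from measurable_comp[OF this f] show ?thesis
      by (intro sigma_finite_measure.borel_measurable_nn_integral)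
         (auto simp: comp_def case_prod_beta' sigma_finite_lborel)
  qed
  have "integral\<^sup>N (leb V) f = (\<integral>\<^sup>+x. \<integral>\<^sup>+t. f (x(j := t)) \<partial>lborel \<partial>leb (insert i ?B))"
    using assms nn_integral_leb_insert[OF _ _ f] V by auto
  also have "\<dots> = (\<integral>\<^sup>+b. \<integral>\<^sup>+s. \<integral>\<^sup>+t. f (b(i := s, j := t)) \<partial>lborel \<partial>lborel \<partial>leb ?B)"
    by (subst nn_integral_leb_insert[OF _ _ g]) (use assms in auto)
  finally show ?thesis .
qed

section \<open>Conditional independence from a factorised density\<close>

text \<open>Here \<open>a\<close> and \<open>b\<close> stand for the two normalising integrals. They
  are positive and finite, so \<open>a / a\<close> and \<open>b / b\<close> equal 1 and the formula
  is the pointwise product rule of conditional independence.\<close>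

lemma enn2real_mult_quotients:
  assumes "0 < a" "a < \<infinity>" "0 < b" "b < (\<infinity>::ennreal)"
  shows "enn2real (x / a * (y / b)) = enn2real (x / a * (b / b)) * enn2real (a / a * (y / b))"
  using assms by (simp add: enn2real_mult ennreal_divide_self)

text \<open>A zero among \<open>a\<close>, \<open>b\<close> forces the corresponding numerator to
  vanish, and both sides are 0. Otherwise finiteness of \<open>a * b\<close> makes both factors
  finite, and the divisions cancel.\<close>

lemma mult_divide_cancel_ennreal:
  fixes a b x y :: ennreal
  assumes "x \<le> a" "y \<le> b" "a * b < \<infinity>"
  shows "x / a * (y / b) * (a * b) = x * y"
proof (cases "a = 0 \<or> b = 0")
  case True
  with assms show ?thesis by auto
next
  case False
  then have "a \<noteq> \<infinity>" "b \<noteq> \<infinity>" using assms by (auto simp: ennreal_top_mult ennreal_mult_top)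
  with False have "x / a * a = x" "y / b * b = y"
    using ennreal_divide_self[of a] ennreal_divide_self[of b]
    by (auto simp: ennreal_divide_times top.not_eq_extremum zero_less_iff_neq_zero)
  then show ?thesis by (metis (no_types, lifting) mult.assoc mult.left_commute)
qed

text \<open>Fixing the remaining coordinates separates the integrals over \<open>y i\<close> and
  \<open>y j\<close>, so conditional expectations of products split. The assumption
  \<open>int\<close> expresses that \<open>M\<close> has density \<open>F * G\<close>, in a form
  that suits a law living on a subset \<open>S\<close>.\<close>

lemma cond_indep_var_of_factorization:
  fixes F G :: "('v \<Rightarrow> real) \<Rightarrow> ennreal"
  assumes fin: "finite V" and ij: "i \<in> V" "j \<in> V" "i \<noteq> j"
    and F [measurable]: "F \<in> borel_measurable (leb V)"
    and G [measurable]: "G \<in> borel_measurable (leb V)"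
    and Fj: "\<And>y t. F (y(j := t)) = F y" and Gi: "\<And>y s. G (y(i := s)) = G y"
    and M: "prob_space M" "S \<in> sets (leb V)" "sets M = sets (restrict_space (leb V) S)"
    and int: "\<And>h. h \<in> borel_measurable (leb V) \<Longrightarrow> integral\<^sup>N M h = (\<integral>\<^sup>+y. h y * (F y * G y) \<partial>leb V)"
  shows "cond_indep_var M (\<Pi>\<^sub>M i\<in>{i}. borel) (\<lambda>y. restrict y {i})
     (\<Pi>\<^sub>M i\<in>{j}. borel) (\<lambda>y. restrict y {j})
     (\<Pi>\<^sub>M i\<in>V - {i, j}. borel) (\<lambda>y. restrict y (V - {i, j}))"
proof -
  interpret prob_space M by fact
  let ?B = "V - {i, j}"
  have V: "V = insert j (insert i ?B)" using ij by auto
  have mM: "f \<in> measurable M N" if "f \<in> measurable (leb V) N" for f and N :: "'z measure"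
    using measurable_restrict_space1[OF that, of S] measurable_cong_sets[OF M(3) refl] by blast
  have rM: "(\<lambda>y. restrict y J) \<in> measurable M (\<Pi>\<^sub>M i\<in>J. borel)" if "J \<subseteq> V" for J
  proof -
    have "(\<lambda>y. restrict y J) \<in> measurable (leb V) (\<Pi>\<^sub>M i\<in>J. borel)"
      using measurable_leb_restrict[OF that] measurable_cong_sets[OF refl sets_leb] by blast
    then show ?thesis by (rule mM)
  qed
  \<comment> \<open>The entry 0 is a filler that puts the vector into \<open>leb V\<close>: by
    \<open>Fj\<close> and \<open>Gi\<close> its value does not matter. The products
    \<open>p u b * q v b\<close> are the unnormalised conditional integrals.\<close>
  define p where "p u b = (\<integral>\<^sup>+s. u s * F (b(i := s, j := 0)) \<partial>lborel)"
      for u :: "real \<Rightarrow> ennreal" and b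
  define q where "q u b = (\<integral>\<^sup>+t. u t * G (b(i := 0, j := t)) \<partial>lborel)"
      for u :: "real \<Rightarrow> ennreal" and b
  have upd: "(\<lambda>(b, s, t). b(i := s, j := t)) \<in> measurable (leb ?B \<Otimes>\<^sub>M borel \<Otimes>\<^sub>M borel) (leb V)"
    using measurable_leb_fun_upd2[of i j ?B] V by simp
  have upd': "(\<lambda>x. (f1 x)(i := f2 x, j := f3 x)) \<in> measurable N (leb V)"
    if "f1 \<in> measurable N (leb ?B)" "f2 \<in> borel_measurable N" "f3 \<in> borel_measurable N"
        for f1 f2 f3 and N :: "'z measure"
  proof -
    have "(\<lambda>x. (f1 x, f2 x, f3 x)) \<in> measurable N (leb ?B \<Otimes>\<^sub>M borel \<Otimes>\<^sub>M borel)"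
      using that by measurable
    from measurable_comp[OF this upd] show ?thesis by (simp add: comp_def)
  qed
  have [measurable]: "(\<lambda>(b, s). F (b(i := s, j := 0))) \<in> borel_measurable (leb ?B \<Otimes>\<^sub>M borel)"
    using measurable_compose[OF upd'[OF measurable_fst measurable_snd measurable_const] F]
    by (simp add: case_prod_beta')
  have [measurable]: "(\<lambda>(b, t). G (b(i := 0, j := t))) \<in> borel_measurable (leb ?B \<Otimes>\<^sub>M borel)"
    using measurable_compose[OF upd'[OF measurable_fst measurable_const measurable_snd] G]
    by (simp add: case_prod_beta')
  have pm [measurable]: "p u \<in> borel_measurable (leb ?B)"
      if [measurable]: "u \<in> borel_measurable borel" for u
    unfolding p_def by measurable
  have qm [measurable]: "q u \<in> borel_measurable (leb ?B)"
      if [measurable]: "u \<in> borel_measurable borel" for u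
    unfolding q_def by measurable
  \<comment> \<open>At fixed \<open>b\<close> the variables separate: \<open>F\<close> sees only
    \<open>s\<close> and \<open>G\<close> only \<open>t\<close>.\<close>
  have key: "(\<integral>\<^sup>+y. u (y i) * v (y j) * \<phi> (restrict y ?B) \<partial>M)
      = (\<integral>\<^sup>+b. \<phi> b * (p u b * q v b) \<partial>leb ?B)"
    if u [measurable]: "u \<in> borel_measurable borel" and v [measurable]: "v \<in> borel_measurable borel"
      and \<phi>: "\<phi> \<in> borel_measurable (leb ?B)" for u v :: "real \<Rightarrow> ennreal" and \<phi>
  proof -
    have [measurable]: "(\<lambda>y. \<phi> (restrict y ?B)) \<in> borel_measurable (leb V)"
      using \<phi> by (intro measurable_leb_restrict_comp) auto
    have [measurable]: "(\<lambda>y. y i) \<in> borel_measurable (leb V)" "(\<lambda>y. y j) \<in> borel_measurable (leb V)"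
      using ij by auto
    have "(\<integral>\<^sup>+y. u (y i) * v (y j) * \<phi> (restrict y ?B) \<partial>M)
        = (\<integral>\<^sup>+y. u (y i) * v (y j) * \<phi> (restrict y ?B) * (F y * G y) \<partial>leb V)"
      by (rule int) measurable
    also have "\<dots> = (\<integral>\<^sup>+b. \<integral>\<^sup>+s. \<integral>\<^sup>+t. u s * v t * \<phi> b * (F (b(i := s, j := 0))
        * G (b(i := 0, j := t))) \<partial>lborel \<partial>lborel \<partial>leb ?B)"
    proof (subst nn_integral_leb_two[OF fin ij], measurable, intro nn_integral_cong)
      fix b s t assume "b \<in> space (leb ?B)"
      then have "restrict (b(i := s, j := t)) ?B = b"
        by (auto simp: space_leb fun_eq_iff PiE_def extensional_def)
      moreover have "F (b(i := s, j := t)) = F (b(i := s, j := 0))"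
        using Fj[of "b(i := s)"] by metis
      moreover have "G (b(i := s, j := t)) = G (b(i := 0, j := t))"
        using Gi[of "b(j := t)"] ij(3) fun_upd_twist by metis
      ultimately show "u ((b(i := s, j := t)) i) * v ((b(i := s, j := t)) j) *
            \<phi> (restrict (b(i := s, j := t)) ?B) * (F (b(i := s, j := t)) * G (b(i := s, j := t))) =
           u s * v t * \<phi> b * (F (b(i := s, j := 0)) * G (b(i := 0, j := t)))"
        using ij(3) by simp
    qed
    also have "\<dots> = (\<integral>\<^sup>+b. \<phi> b * (p u b * q v b) \<partial>leb ?B)"
    proof (rule nn_integral_cong)
      fix b assume b: "b \<in> space (leb ?B)"
      have [measurable]: "(\<lambda>s. F (b(i := s, j := 0))) \<in> borel_measurable borel"
          "(\<lambda>t. G (b(i := 0, j := t))) \<in> borel_measurable borel"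
        using b by (auto intro!: measurable_compose[OF upd' F] measurable_compose[OF upd' G])
      have "(\<integral>\<^sup>+s. \<integral>\<^sup>+t. u s * v t * \<phi> b * (F (b(i := s, j := 0))
          * G (b(i := 0, j := t))) \<partial>lborel \<partial>lborel)
          = (\<integral>\<^sup>+s. (u s * F (b(i := s, j := 0)) * \<phi> b) * (\<integral>\<^sup>+t. v t
              * G (b(i := 0, j := t)) \<partial>lborel) \<partial>lborel)"
      proof (rule nn_integral_cong)
        fix s
        show "(\<integral>\<^sup>+t. u s * v t * \<phi> b * (F (b(i := s, j := 0)) * G (b(i := 0, j := t))) \<partial>lborel)
          = u s * F (b(i := s, j := 0)) * \<phi> b * (\<integral>\<^sup>+t. v t * G (b(i := 0, j := t)) \<partial>lborel)"
          by (subst nn_integral_cmult[symmetric]) (simp_all add: ac_simps)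
      qed
      also have "\<dots> = (\<integral>\<^sup>+s. u s * F (b(i := s, j := 0)) * (\<phi> b * q v b) \<partial>lborel)"
        by (simp add: q_def ac_simps)
      also have "\<dots> = p u b * (\<phi> b * q v b)"
        unfolding p_def by (rule nn_integral_multc) simp
      finally show "(\<integral>\<^sup>+s. \<integral>\<^sup>+t. u s * v t * \<phi> b * (F (b(i := s, j := 0))
          * G (b(i := 0, j := t))) \<partial>lborel \<partial>lborel)
          = \<phi> b * (p u b * q v b)" by (simp add: ac_simps)
    qed
    finally show ?thesis .
  qed
  let ?p = "p (\<lambda>_. 1)" and ?q = "q (\<lambda>_. 1)"
  \<comment> \<open>Constant test functions show that the density \<open>?p * ?q\<close> of the
    conditioning vector has total mass one, hence is finite almost everywhere.\<close>
  have "(\<integral>\<^sup>+b. 1 * (?p b * ?q b) \<partial>leb ?B) = (\<integral>\<^sup>+y. 1 * 1 * 1 \<partial>M)"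
    by (rule key[symmetric, of "\<lambda>_. 1" "\<lambda>_. 1" "\<lambda>_. 1"]) (rule measurable_const, simp)+
  then have total: "(\<integral>\<^sup>+b. ?p b * ?q b \<partial>leb ?B) = 1"
    unfolding mult_1 nn_integral_const emeasure_space_1 .
  have pq [measurable]: "?p \<in> borel_measurable (leb ?B)" "?q \<in> borel_measurable (leb ?B)"
    by (rule pm qm, rule measurable_const, simp)+
  then have "AE b in leb ?B. ?p b * ?q b \<noteq> \<infinity>"
    by (intro nn_integral_PInf_AE borel_measurable_times_ennreal) (simp_all only: total, simp)
  then have fin_AE: "AE b in leb ?B. ?p b * ?q b < \<infinity>"
    by eventually_elim (simp add: top.not_eq_extremum)
  \<comment> \<open>\<open>N\<close> collects the values at which the normalising denominator is 0
    or infinite. The law of the conditioning vector gives it no mass: its density is zero at the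
    former, and the latter are Lebesgue null.\<close>
  define N where "N = {b \<in> space (leb ?B). \<not> (0 < ?p b * ?q b \<and> ?p b * ?q b < \<infinity>)}"
  have [measurable]: "N \<in> sets (leb ?B)" unfolding N_def by measurable
  have "(\<integral>\<^sup>+y. indicator N (restrict y ?B) \<partial>M) = (\<integral>\<^sup>+b. indicator N b * (?p b * ?q b) \<partial>leb ?B)"
    using key[OF measurable_const measurable_const, of 1 1 "indicator N"]
    by (simp del: nn_integral_indicator)
  also have "\<dots> = (\<integral>\<^sup>+b. 0 \<partial>leb ?B)"
    by (rule nn_integral_cong_AE, use fin_AE in eventually_elim)
       (auto simp: N_def indicator_def zero_less_iff_neq_zero)
  finally have N0: "(\<integral>\<^sup>+y. indicator N (restrict y ?B) \<partial>M) = 0" by simp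
  have "(\<lambda>y. indicator N (restrict y ?B) :: ennreal) \<in> borel_measurable M"
    by (rule mM, rule measurable_leb_restrict_comp) auto
  from N0 nn_integral_0_iff_AE[OF this] have "AE y in M. indicator N (restrict y ?B) = (0::ennreal)"
    by simp
  moreover have "AE y in M. restrict y ?B \<in> space (leb ?B)"
    by (rule AE_I2) (auto simp: space_leb)
  ultimately have good: "AE y in M. 0 < ?p (restrict y ?B) * ?q (restrict y ?B) \<and>
      ?p (restrict y ?B) * ?q (restrict y ?B) < \<infinity>"
    by eventually_elim (auto simp: N_def indicator_def zero_less_iff_neq_zero split: if_splits)
  let ?A = "vimage_algebra (space M) (\<lambda>y. restrict y ?B) (\<Pi>\<^sub>M i\<in>?B. borel)"
  interpret finite_measure_subalgebra M ?A
  proof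
    show "subalgebra M ?A"
      using sets_image_in_sets[OF refl rM] by (auto simp: subalgebra_def)
  qed
  have restr: "(\<lambda>y. restrict y ?B) \<in> measurable ?A (leb ?B)"
  proof -
    have "(\<lambda>y. restrict y ?B) \<in> measurable ?A (\<Pi>\<^sub>M i\<in>?B. borel)"
      by (rule measurable_vimage_algebra1) (auto simp: space_PiM)
    then show ?thesis using measurable_cong_sets[OF refl sets_leb] by blast
  qed
  txt \<open>
    The expected quotient \<open>p u * q v / (?p * ?q)\<close> is written as a product of two quotients, so that it
    splits into the cases \<open>v = 1\<close> and \<open>u = 1\<close>.
  \<close>
  have ce: "AE y in M. real_cond_exp M ?A f y
      = enn2real (p u (restrict y ?B) / ?p (restrict y ?B)
          * (q v (restrict y ?B) / ?q (restrict y ?B)))"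
    if u [measurable]: "u \<in> borel_measurable borel" and v [measurable]: "v \<in> borel_measurable borel"
      and u1: "\<And>s. u s \<le> 1" and v1: "\<And>s. v s \<le> 1" and f0: "\<And>y. 0 \<le> f y"
      and f: "\<And>y. ennreal (f y) = u (y i) * v (y j)" for u v :: "real \<Rightarrow> ennreal" and f
  proof -
    let ?r = "\<lambda>b. p u b / ?p b * (q v b / ?q b)"
    have [measurable]: "(\<lambda>y. y i) \<in> borel_measurable M" "(\<lambda>y. y j) \<in> borel_measurable M"
      using ij by (auto intro!: mM)
    have "AE y in M. ?r (restrict y ?B) = nn_cond_exp M ?A (\<lambda>y. ennreal (f y)) y"
    \<comment> \<open>It suffices to compare integrals over sets of the generated sigma-algebra.
      These are the preimages of sets \<open>K\<close> of conditioning values, so both integrals are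
      instances of \<open>key\<close>.\<close>
    proof (rule nn_cond_exp_charact)
      show "(\<lambda>y. ennreal (f y)) \<in> borel_measurable M" unfolding f by measurable
      have r: "?r \<in> borel_measurable (leb ?B)"
        by (intro borel_measurable_times_ennreal borel_measurable_divide_ennreal pm qm u v
            measurable_const) simp_all
      from measurable_comp[OF restr r] show "(\<lambda>y. ?r (restrict y ?B)) \<in> borel_measurable ?A"
        by (simp add: comp_def)
      fix A assume "A \<in> sets ?A"
      then obtain K where K: "K \<in> sets (leb ?B)" "A = (\<lambda>y. restrict y ?B) -` K \<inter> space M"
        by (subst (asm) sets_vimage_algebra2) (auto simp: sets_leb space_PiM)
      have AK: "indicator A y = (indicator K (restrict y ?B) :: ennreal)" if "y \<in> space M" for y
        using that K(2) by (auto simp: indicator_def)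
      have K' [measurable]: "indicator K \<in> borel_measurable (leb ?B)" using K(1) by simp
      have "(\<integral>\<^sup>+y\<in>A. ennreal (f y) \<partial>M) = (\<integral>\<^sup>+y. u (y i) * v (y j) * indicator K (restrict y ?B) \<partial>M)"
        by (rule nn_integral_cong) (simp add: AK f)
      also have "\<dots> = (\<integral>\<^sup>+b. indicator K b * (p u b * q v b) \<partial>leb ?B)"
        by (rule key) (use K' in auto)
      also have "\<dots> = (\<integral>\<^sup>+b. indicator K b * ?r b * (?p b * ?q b) \<partial>leb ?B)"
      proof (rule nn_integral_cong_AE, use fin_AE in eventually_elim)
        fix b assume "?p b * ?q b < \<infinity>"
        moreover have "p u b \<le> ?p b" unfolding p_def
          by (intro nn_integral_mono mult_right_mono u1) simp
        moreover have "q v b \<le> ?q b" unfolding q_def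
          by (intro nn_integral_mono mult_right_mono v1) simp
        ultimately show "indicator K b * (p u b * q v b) = indicator K b * ?r b * (?p b * ?q b)"
          using mult_divide_cancel_ennreal by (simp add: mult.assoc)
      qed
      also have "\<dots> = (\<integral>\<^sup>+y. 1 * 1 * (indicator K (restrict y ?B) * ?r (restrict y ?B)) \<partial>M)"
        by (rule key[symmetric]) (use K r in \<open>auto intro!: borel_measurable_times_ennreal\<close>)
      also have "\<dots> = (\<integral>\<^sup>+y\<in>A. ?r (restrict y ?B) \<partial>M)"
        by (rule nn_integral_cong) (simp add: AK mult.commute)
      finally show "(\<integral>\<^sup>+y\<in>A. ennreal (f y) \<partial>M) = (\<integral>\<^sup>+y\<in>A. ?r (restrict y ?B) \<partial>M)" .
    qed
    \<comment> \<open>\<open>real_cond_exp\<close> is the difference of the conditional expectations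
      of the positive and the negative part; as \<open>f\<close> is non-negative, the latter is
      0.\<close>
    moreover have "AE y in M. 0 = nn_cond_exp M ?A (\<lambda>y. ennreal (- f y)) y"
      by (rule nn_cond_exp_charact) (auto simp: ennreal_neg f0)
    ultimately show ?thesis
      by eventually_elim (simp add: real_cond_exp_def)
  qed
  show ?thesis
    unfolding cond_indep_var_def
  proof (intro conjI ballI rM)
    fix X Y :: "('v \<Rightarrow> real) set"
    assume X: "X \<in> sets (\<Pi>\<^sub>M k\<in>{i}. borel)" and Y: "Y \<in> sets (\<Pi>\<^sub>M k\<in>{j}. borel)"
    \<comment> \<open>A vector with one coordinate is determined by its entry, so the events
      \<open>X\<close> and \<open>Y\<close> become tests of a single real number.\<close>
    let ?u = "\<lambda>s. indicator X (\<lambda>k\<in>{i}. s) :: ennreal"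
      and ?v = "\<lambda>s. indicator Y (\<lambda>k\<in>{j}. s) :: ennreal"
    have u: "?u \<in> borel_measurable borel"
      by (rule measurable_compose[OF measurable_restrict borel_measurable_indicator[OF X]]) simp
    have v: "?v \<in> borel_measurable borel"
      by (rule measurable_compose[OF measurable_restrict borel_measurable_indicator[OF Y]]) simp
    have "restrict y {k} = (\<lambda>l\<in>{k}. y k)" for y :: "'v \<Rightarrow> real" and k by auto
    then have fu: "ennreal (indicator X (restrict y {i})) = ?u (y i)"
      and fv: "ennreal (indicator Y (restrict y {j})) = ?v (y j)" for y
      by (simp_all only: ennreal_indicator)
    have "AE y in M. real_cond_exp M ?A (\<lambda>y. indicator X (restrict y {i})
        * indicator Y (restrict y {j})) y
      = enn2real (p ?u (restrict y ?B) / ?p (restrict y ?B)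
          * (q ?v (restrict y ?B) / ?q (restrict y ?B)))"
      by (rule ce[OF u v]) (simp_all add: ennreal_mult fu fv, simp_all add: indicator_def)
    moreover have "AE y in M. real_cond_exp M ?A (\<lambda>y. indicator X (restrict y {i})) y
      = enn2real (p ?u (restrict y ?B) / ?p (restrict y ?B)
          * (?q (restrict y ?B) / ?q (restrict y ?B)))"
      by (rule ce[OF u]) (simp_all add: fu, simp_all add: indicator_def)
    moreover have "AE y in M. real_cond_exp M ?A (\<lambda>y. indicator Y (restrict y {j})) y
      = enn2real (?p (restrict y ?B) / ?p (restrict y ?B)
          * (q ?v (restrict y ?B) / ?q (restrict y ?B)))"
      by (rule ce[OF _ v]) (simp_all add: fv, simp_all add: indicator_def)
    ultimately show "AE y in M. real_cond_exp M ?A (\<lambda>y. indicator X (restrict y {i})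
        * indicator Y (restrict y {j})) y
        = real_cond_exp M ?A (\<lambda>y. indicator X (restrict y {i})) y
            * real_cond_exp M ?A (\<lambda>y. indicator Y (restrict y {j})) y"
      using good
    proof eventually_elim
      case (elim y)
      then have "0 < ?p (restrict y ?B)" "?p (restrict y ?B) < \<infinity>"
          "0 < ?q (restrict y ?B)" "?q (restrict y ?B) < \<infinity>"
        by (auto simp: ennreal_zero_less_mult_iff ennreal_mult_less_top)
      from enn2real_mult_quotients[OF this] show ?case
        unfolding elim(1-3) .
    qed
  qed (use ij in auto)
qed

section \<open>Marginals along a clique ordering\<close>

text \<open>
  Cutting a density off outside the open orthant turns the consistency condition, which is assumed
  at positive points only, into an identity at all points, and makes the density vanish exactly off
  the open orthant.
\<close>

definition pos_part_density :: "'v set \<Rightarrow> (('v \<Rightarrow> real) \<Rightarrow> real) \<Rightarrow> ('v \<Rightarrow> real) \<Rightarrow> real" where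
  "pos_part_density I f y = indicator (pos_orthant I) y * f y"

text \<open>The clique quotient over the first \<open>n\<close> cliques, indexed by position to
  allow induction on \<open>n\<close>. The separator product starts at position 1 because the first
  clique has no separator.\<close>

definition chain_density :: "'v set list \<Rightarrow> ('v set \<Rightarrow> ('v \<Rightarrow> real) \<Rightarrow> real) \<Rightarrow> nat \<Rightarrow>
    ('v \<Rightarrow> real) \<Rightarrow> real" where
  "chain_density Cs g n y =
     (\<Prod>l<n. g (Cs ! l) (restrict y (Cs ! l))) /
     (\<Prod>l\<in>{1..<n}. g (separator_at Cs l) (restrict y (separator_at Cs l)))"

text \<open>Consistency is required for every clique containing a separator: it is used for the
  clique being appended and again for an earlier clique that contains its separator. All conditions
  hold at every point of the space, so no exceptional sets need tracking.\<close>

definition marginal_family :: "'v set list \<Rightarrow> ('v set \<Rightarrow> ('v \<Rightarrow> real) \<Rightarrow> real) \<Rightarrow> bool" where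
  "marginal_family Cs g \<longleftrightarrow>
     (\<forall>C\<in>set Cs. finite C \<and> g C \<in> borel_measurable (leb C) \<and>
       (\<forall>y\<in>space (leb C). 0 \<le> g C y \<and> (g C y \<noteq> 0 \<longleftrightarrow> y \<in> pos_orthant C))) \<and>
     (\<forall>l\<in>{1..<length Cs}. let D = separator_at Cs l in
       g D \<in> borel_measurable (leb D) \<and>
       (\<forall>y\<in>space (leb D). 0 \<le> g D y \<and> (g D y \<noteq> 0 \<longleftrightarrow> y \<in> pos_orthant D)) \<and>
       (\<forall>C\<in>set Cs. D \<subseteq> C \<longrightarrow> (\<forall>y\<in>space (leb D).
          (\<integral>\<^sup>+z. ennreal (g C (merge D (C - D) (y, z))) \<partial>leb (C - D)) = ennreal (g D y))))"

lemma pos_orthant_restrict: "y \<in> pos_orthant I \<Longrightarrow> J \<subseteq> I \<Longrightarrow> restrict y J \<in> pos_orthant J"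
  by (auto simp: pos_orthant_def PiE_iff)

lemma marginal_familyD:
  assumes "marginal_family Cs g"
  shows "C \<in> set Cs \<Longrightarrow> finite C"
    and "C \<in> set Cs \<Longrightarrow> g C \<in> borel_measurable (leb C)"
    and "C \<in> set Cs \<Longrightarrow> y \<in> space (leb C) \<Longrightarrow> 0 \<le> g C y"
    and "C \<in> set Cs \<Longrightarrow> y \<in> space (leb C) \<Longrightarrow> g C y \<noteq> 0 \<longleftrightarrow> y \<in> pos_orthant C"
    and "1 \<le> l \<Longrightarrow> l < length Cs \<Longrightarrow> g (separator_at Cs l) \<in> borel_measurable (leb (separator_at Cs l))"
    and "1 \<le> l \<Longrightarrow> l < length Cs \<Longrightarrow> y \<in> space (leb (separator_at Cs l)) \<Longrightarrow> 0 \<le> g (separator_at Cs l) y"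
    and "1 \<le> l \<Longrightarrow> l < length Cs \<Longrightarrow> y \<in> space (leb (separator_at Cs l)) \<Longrightarrow>
      g (separator_at Cs l) y \<noteq> 0 \<longleftrightarrow> y \<in> pos_orthant (separator_at Cs l)"
    and "1 \<le> l \<Longrightarrow> l < length Cs \<Longrightarrow> C \<in> set Cs \<Longrightarrow> separator_at Cs l \<subseteq> C
        \<Longrightarrow> y \<in> space (leb (separator_at Cs l)) \<Longrightarrow>
      (\<integral>\<^sup>+z. ennreal (g C (merge (separator_at Cs l) (C - separator_at Cs l) (y, z))) \<partial>leb
          (C - separator_at Cs l))
       = ennreal (g (separator_at Cs l) y)"
  using assms unfolding marginal_family_def Let_def by auto

lemma measurable_leb_merge_Pair:
  assumes "f \<in> measurable (leb (I \<union> J)) N" "x \<in> space (leb I)"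
  shows "(\<lambda>z. f (merge I J (x, z))) \<in> measurable (leb J) N"
  using assms by (intro measurable_compose[OF measurable_Pair1' measurable_compose[OF
      measurable_leb_merge]])

lemma borel_measurable_nn_integral_merge:
  assumes "f \<in> borel_measurable (leb (I \<union> J))" "finite J"
  shows "(\<lambda>x. \<integral>\<^sup>+z. f (merge I J (x, z)) \<partial>leb J) \<in> borel_measurable (leb I)"
  using measurable_compose[OF measurable_leb_merge assms(1)]
  by (intro sigma_finite_measure.borel_measurable_nn_integral sigma_finite_leb assms)
     (simp add: case_prod_beta')

text \<open>With \<open>U\<close> the vertices already covered, the clique \<open>C\<close> sees the
  old vector only through \<open>C \<inter> U\<close>, the prospective separator.\<close>

lemma restrict_merge_Diff:
  assumes "x \<in> space (leb U)"
  shows "restrict (merge U (C - U) (x, z)) C = merge (C \<inter> U) (C - U) (restrict x (C \<inter> U), z)"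
  using assms by (auto simp: merge_def fun_eq_iff)

section \<open>Induction over the clique ordering\<close>

context
  fixes Cs :: "'v set list" and g :: "'v set \<Rightarrow> ('v \<Rightarrow> real) \<Rightarrow> real"
  assumes fam: "marginal_family Cs g"
begin

lemma separator_at_subset: "l < n \<Longrightarrow> separator_at Cs l \<subseteq> (\<Union>j<n. Cs ! j)"
  by (auto simp: separator_at_def)

lemma chain_density_measurable:
  assumes "n \<le> length Cs"
  shows "chain_density Cs g n \<in> borel_measurable (leb (\<Union>j<n. Cs ! j))"
  unfolding chain_density_def[abs_def]
proof (intro borel_measurable_divide borel_measurable_prod)
  fix l assume "l \<in> {..<n}"
  then show "(\<lambda>y. g (Cs ! l) (restrict y (Cs ! l))) \<in> borel_measurable (leb (\<Union>j<n. Cs ! j))"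
    using assms by (intro measurable_leb_restrict_comp marginal_familyD(2)[OF fam]) auto
next
  fix l assume "l \<in> {1..<n}"
  then show "(\<lambda>y. g (separator_at Cs l) (restrict y (separator_at Cs l)))
      \<in> borel_measurable (leb (\<Union>j<n. Cs ! j))"
    using assms by (intro measurable_leb_restrict_comp marginal_familyD(5)[OF fam]
        separator_at_subset) auto
qed

lemma chain_density_nonneg:
  assumes "n \<le> length Cs"
  shows "0 \<le> chain_density Cs g n y"
  unfolding chain_density_def using assms
  by (intro divide_nonneg_nonneg prod_nonneg ballI marginal_familyD[OF fam]) (auto simp: space_leb)

text \<open>A non-zero product has non-zero clique factors, so \<open>y\<close> is positive on each
  clique, and the cliques cover the index set.\<close>

lemma chain_density_nonzero:
  assumes "n \<le> length Cs" "y \<in> space (leb (\<Union>j<n. Cs ! j))" "chain_density Cs g n y \<noteq> 0"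
  shows "y \<in> pos_orthant (\<Union>j<n. Cs ! j)"
proof -
  have "restrict y (Cs ! l) \<in> pos_orthant (Cs ! l)" if "l < n" for l
  proof -
    have "g (Cs ! l) (restrict y (Cs ! l)) \<noteq> 0"
      using assms(3) that by (auto simp: chain_density_def)
    then show ?thesis
      using marginal_familyD(4)[OF fam, of "Cs ! l" "restrict y (Cs ! l)"] assms(1) that
      by (auto simp: space_leb)
  qed
  then show ?thesis using assms(2) by (fastforce simp: pos_orthant_def PiE_iff space_leb)
qed

text \<open>Old factors do not see \<open>z\<close>. The only new factors belong to the appended
  clique and its separator, and the separator factor depends on the old coordinates alone.\<close>

lemma chain_density_Suc_merge:
  assumes "1 \<le> n" "x \<in> space (leb (\<Union>j<n. Cs ! j))"
  defines "U \<equiv> \<Union>j<n. Cs ! j" and "D \<equiv> separator_at Cs n"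
  shows "chain_density Cs g (Suc n) (merge U (Cs ! n - D) (x, z)) = chain_density Cs g n x *
     (g (Cs ! n) (merge D (Cs ! n - D) (restrict x D, z)) / g D (restrict x D))"
proof -
  have D: "D = Cs ! n \<inter> U" by (simp add: D_def U_def separator_at_def)
  have diff: "Cs ! n - D = Cs ! n - U" by (auto simp: D)
  let ?y = "merge U (Cs ! n - U) (x, z)"
  have r: "restrict ?y J = restrict x J" if "J \<subseteq> U" for J
    using that by (auto simp: merge_def fun_eq_iff)
  have sub: "Cs ! l \<subseteq> U" "separator_at Cs l \<subseteq> U" if "l < n" for l
    using that separator_at_subset[OF that] by (auto simp: U_def)
  have "restrict ?y (Cs ! n) = merge D (Cs ! n - U) (restrict x D, z)"
    using restrict_merge_Diff[of x U] assms by (simp add: D)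
  moreover have "{1..<Suc n} = insert n {1..<n}" using assms(1) by auto
  moreover have "restrict ?y D = restrict x D" by (rule r) (auto simp: D)
  ultimately show ?thesis
    unfolding chain_density_def diff
    by (simp add: sub r flip: D_def)
qed

text \<open>Fubini over \<open>D\<close> and \<open>C - D\<close>: the test function depends on the
  first block only, and consistency evaluates the inner integral.\<close>

lemma nn_integral_marginal:
  assumes l: "1 \<le> n" "n < length Cs" and C: "C \<in> set Cs" "separator_at Cs n \<subseteq> C"
    and h: "h \<in> borel_measurable (leb (separator_at Cs n))"
  shows "(\<integral>\<^sup>+u. h (restrict u (separator_at Cs n)) * ennreal (g C u) \<partial>leb C)
    = (\<integral>\<^sup>+w. h w * ennreal (g (separator_at Cs n) w) \<partial>leb (separator_at Cs n))"
proof -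
  let ?D = "separator_at Cs n"
  have fin: "finite C" "finite ?D" using marginal_familyD(1)[OF fam C(1)] C(2) finite_subset by auto
  have U: "?D \<union> (C - ?D) = C" using C by auto
  have gC: "g C \<in> borel_measurable (leb C)" by (rule marginal_familyD(2)[OF fam C(1)])
  have "(\<integral>\<^sup>+u. h (restrict u ?D) * ennreal (g C u) \<partial>leb C)
     = (\<integral>\<^sup>+w. \<integral>\<^sup>+z. h (restrict (merge ?D (C - ?D) (w, z)) ?D)
         * ennreal (g C (merge ?D (C - ?D) (w, z))) \<partial>leb (C - ?D) \<partial>leb ?D)"
    using nn_integral_leb_fold[of ?D "C - ?D"] fin U gC measurable_leb_restrict_comp[OF C(2) h]
    by auto
  also have "\<dots> = (\<integral>\<^sup>+w. h w * ennreal (g ?D w) \<partial>leb ?D)"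
  proof (rule nn_integral_cong)
    fix w assume w: "w \<in> space (leb ?D)"
    then have "restrict (merge ?D (C - ?D) (w, z)) ?D = w" for z
      by (auto simp: space_leb fun_eq_iff PiE_def extensional_def)
    then show "(\<integral>\<^sup>+z. h (restrict (merge ?D (C - ?D) (w, z)) ?D)
        * ennreal (g C (merge ?D (C - ?D) (w, z))) \<partial>leb (C - ?D))
        = h w * ennreal (g ?D w)"
      using measurable_leb_merge_Pair[of "g C" ?D "C - ?D"] w U gC marginal_familyD(8)[OF fam l C w]
      by (simp add: nn_integral_cmult)
  qed
  finally show ?thesis .
qed

text \<open>The test function \<open>h\<close> encodes that the marginal on \<open>Cs ! l\<close> is
  \<open>g (Cs ! l)\<close>. Both \<open>l\<close> and \<open>h\<close> stay general in the
  induction, because the newest clique is reduced to an earlier one with a different test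
  function.\<close>

lemma nn_integral_chain_density:
  assumes rip: "running_intersection Cs"
    and "l < n" "n \<le> length Cs" "h \<in> borel_measurable (leb (Cs ! l))"
  shows "(\<integral>\<^sup>+y. h (restrict y (Cs ! l)) * ennreal (chain_density Cs g n y) \<partial>leb (\<Union>j<n. Cs ! j))
    = (\<integral>\<^sup>+z. h z * ennreal (g (Cs ! l) z) \<partial>leb (Cs ! l))"
  using assms(2-)
proof (induction n arbitrary: l h)
  case 0
  then show ?case by simp
next
  case (Suc n)
  show ?case
  proof (cases "n = 0")
    case True
    then have "restrict y (Cs ! 0) = y" if "y \<in> space (leb (Cs ! 0))" for y
      using that by (simp add: space_leb PiE_def extensional_restrict)
    moreover have "l = 0" "(\<Union>j<Suc n. Cs ! j) = Cs ! 0"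
      "chain_density Cs g (Suc n) y = g (Cs ! 0) (restrict y (Cs ! 0))" for y
      using True Suc.prems by (auto simp: chain_density_def)
    ultimately show ?thesis
      by (simp only: True) (intro nn_integral_cong, simp only:)
  next
    case False
    then have n: "1 \<le> n" "n < length Cs" using Suc.prems by auto
    define U D C where "U = (\<Union>j<n. Cs ! j)" and "D = separator_at Cs n" and "C = Cs ! n"
    have D: "D = C \<inter> U" by (simp add: D_def C_def U_def separator_at_def)
    have C: "C \<in> set Cs" using n by (simp add: C_def)
    have finC: "finite C" using marginal_familyD(1)[OF fam C] .
    have finU: "finite U" using n by (auto simp: U_def intro!: marginal_familyD(1)[OF fam])
    have US: "(\<Union>j<Suc n. Cs ! j) = U \<union> (C - D)" by (auto simp: U_def C_def D lessThan_Suc)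
    have disj: "U \<inter> (C - D) = {}" by (auto simp: D)
    have DC: "D \<union> (C - D) = C" by (auto simp: D)
    have gC: "g C \<in> borel_measurable (leb C)" by (rule marginal_familyD(2)[OF fam C])
    have gD: "g D \<in> borel_measurable (leb D)" unfolding D_def
      by (rule marginal_familyD(5)[OF fam n])
    have gD0: "0 \<le> g D w" if "w \<in> space (leb D)" for w using marginal_familyD(6)[OF fam n] that
      by (simp add: D_def)
    have gDz: "(g D w \<noteq> 0) = (w \<in> pos_orthant D)" if "w \<in> space (leb D)" for w
      using marginal_familyD(7)[OF fam n] that by (simp add: D_def)
    have marg: "(\<integral>\<^sup>+z. ennreal (g C (merge D (C - D) (w, z))) \<partial>leb (C - D)) = ennreal (g D w)"
        if "w \<in> space (leb D)" for w
      using marginal_familyD(8)[OF fam n C] that by (simp add: D_def C_def separator_at_def)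
    have cd0: "0 \<le> chain_density Cs g n y" for y using chain_density_nonneg n by simp
    have "l \<le> n" using Suc.prems by simp
    have Cl: "Cs ! l \<subseteq> U \<union> (C - D)" using Suc.prems(1) by (auto simp flip: US)
    let ?m = "\<lambda>x z. merge D (C - D) (restrict x D, z)"
    have rD: "restrict x D \<in> space (leb D)" for x by (simp add: space_leb)
    \<comment> \<open>Division by 0 gives 0 in the reals, but infinity for a positive numerator in
      \<open>ennreal\<close>. Where the previous chain density is non-zero this positivity makes the
      two quotients agree; elsewhere the factor 0 removes them.\<close>
    have gD_pos: "0 < g D (restrict x D)"
        if x: "x \<in> space (leb U)" and "chain_density Cs g n x \<noteq> 0" for x
    proof -
      have "x \<in> pos_orthant U"
        using chain_density_nonzero[of n x] n that by (simp add: U_def)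
      then have "g D (restrict x D) \<noteq> 0" using gDz[OF rD] pos_orthant_restrict[of x U D] D by auto
      then show ?thesis using gD0[OF rD, of x] by simp
    qed
    have mC: "?m x z \<in> space (leb C)" if "z \<in> space (leb (C - D))" for x z
      using that DC by (auto simp: space_leb PiE_iff extensional_def merge_def)
    have meas: "(\<lambda>y. h (restrict y (Cs ! l)) * ennreal (chain_density Cs g (Suc n) y))
        \<in> borel_measurable (leb (U \<union> (C - D)))"
      using chain_density_measurable[OF Suc.prems(2)] unfolding US
      by (intro borel_measurable_times_ennreal measurable_leb_restrict_comp[OF Cl Suc.prems(3)])
          simp
    have split: "(\<integral>\<^sup>+y. h (restrict y (Cs ! l))
        * ennreal (chain_density Cs g (Suc n) y) \<partial>leb (\<Union>j<Suc n. Cs ! j))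
      = (\<integral>\<^sup>+x. \<integral>\<^sup>+z. h (restrict (merge U (C - D) (x, z)) (Cs ! l)) *
           (ennreal (chain_density Cs g n x)
               * (ennreal (g C (?m x z)) / ennreal (g D (restrict x D)))) \<partial>leb (C - D) \<partial>leb U)"
      unfolding US
    proof (subst nn_integral_leb_fold[OF disj finU _ meas], use finC in simp, intro
        nn_integral_cong)
      fix x z assume x: "x \<in> space (leb U)" and z: "z \<in> space (leb (C - D))"
      have e: "chain_density Cs g (Suc n) (merge U (C - D) (x, z))
          = chain_density Cs g n x * (g C (?m x z) / g D (restrict x D))"
        using chain_density_Suc_merge[OF n(1), of x z] x unfolding C_def D_def U_def by simp
      have "ennreal (chain_density Cs g n x * (g C (?m x z) / g D (restrict x D)))
         = ennreal (chain_density Cs g n x)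
             * (ennreal (g C (?m x z)) / ennreal (g D (restrict x D)))"
      proof (cases "chain_density Cs g n x = 0")
        case False
        then have "0 < g D (restrict x D)" by (rule gD_pos[OF x])
        then show ?thesis
          using cd0 marginal_familyD(3)[OF fam C mC[OF z]]
          by (simp add: ennreal_mult' divide_ennreal del: times_divide_eq_right)
      qed simp
      then show "h (restrict (merge U (C - D) (x, z)) (Cs ! l))
          * ennreal (chain_density Cs g (Suc n) (merge U (C - D) (x, z)))
         = h (restrict (merge U (C - D) (x, z)) (Cs ! l)) * (ennreal (chain_density Cs g n x)
             * (ennreal (g C (?m x z)) / ennreal (g D (restrict x D))))"
        by (simp add: e)
    qed
    have gm: "(\<lambda>z. ennreal (g C (?m x z))) \<in> borel_measurable (leb (C - D))" for x
      using measurable_leb_merge_Pair[of "\<lambda>u. ennreal (g C u)" D "C - D", OF _ rD] gC DC by simp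
    show ?thesis
    proof (cases "l < n")
      case True
      \<comment> \<open>For an earlier clique the test function ignores the new coordinates, and
        integrating the kernel over them gives 1.\<close>
      then have ClU: "Cs ! l \<subseteq> U" by (auto simp: U_def)
      have "(\<integral>\<^sup>+x. \<integral>\<^sup>+z. h (restrict (merge U (C - D) (x, z)) (Cs ! l)) *
           (ennreal (chain_density Cs g n x)
               * (ennreal (g C (?m x z)) / ennreal (g D (restrict x D)))) \<partial>leb (C - D) \<partial>leb U)
        = (\<integral>\<^sup>+x. h (restrict x (Cs ! l)) * ennreal (chain_density Cs g n x) \<partial>leb U)"
      proof (rule nn_integral_cong)
        fix x assume x: "x \<in> space (leb U)"
        have "restrict (merge U (C - D) (x, z)) (Cs ! l) = restrict x (Cs ! l)" for z
          using ClU by (auto simp: merge_def fun_eq_iff)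
        then have "(\<integral>\<^sup>+z. h (restrict (merge U (C - D) (x, z)) (Cs ! l)) *
           (ennreal (chain_density Cs g n x)
               * (ennreal (g C (?m x z)) / ennreal (g D (restrict x D)))) \<partial>leb (C - D))
          = (\<integral>\<^sup>+z. (h (restrict x (Cs ! l))
              * ennreal (chain_density Cs g n x) / ennreal (g D (restrict x D)))
              * ennreal (g C (?m x z)) \<partial>leb (C - D))"
          by (intro nn_integral_cong) (simp add: divide_ennreal_def ac_simps)
        also have "\<dots> = h (restrict x (Cs ! l))
            * ennreal (chain_density Cs g n x) / ennreal (g D (restrict x D))
            * ennreal (g D (restrict x D))"
          by (subst nn_integral_cmult) (use gm marg[OF rD] in auto)
        also have "\<dots> = h (restrict x (Cs ! l)) * ennreal (chain_density Cs g n x)"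
        proof (cases "chain_density Cs g n x = 0")
          case False
          then have "0 < g D (restrict x D)" by (rule gD_pos[OF x])
          then show ?thesis by (simp add: ennreal_divide_times ennreal_divide_self)
        qed simp
        finally show "(\<integral>\<^sup>+z. h (restrict (merge U (C - D) (x, z)) (Cs ! l)) *
           (ennreal (chain_density Cs g n x)
               * (ennreal (g C (?m x z)) / ennreal (g D (restrict x D)))) \<partial>leb (C - D))
           = h (restrict x (Cs ! l)) * ennreal (chain_density Cs g n x)" .
      qed
      also have "\<dots> = (\<integral>\<^sup>+z. h z * ennreal (g (Cs ! l) z) \<partial>leb (Cs ! l))"
        unfolding U_def by (rule Suc.IH[OF True _ Suc.prems(3)]) (use n in simp)
      finally show ?thesis by (rule trans[OF split])
    next
      case False
      with \<open>l \<le> n\<close> have [simp]: "l = n" by simp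
      \<comment> \<open>The running intersection property supplies an earlier clique containing the
        whole separator. The induction hypothesis is applied at this \<open>k\<close>, with a test
        function of the separator coordinates.\<close>
      obtain k where k: "k < n" "D \<subseteq> Cs ! k"
        using rip n unfolding running_intersection_def D_def by blast
      have Ck: "Cs ! k \<in> set Cs" using k n by auto
      have h: "h \<in> borel_measurable (leb C)" using Suc.prems by (simp add: C_def)
      \<comment> \<open>Where \<open>g D w\<close> is positive, \<open>K w / g D w\<close> is the
        conditional mean of \<open>h\<close> given the value \<open>w\<close> on the
        separator.\<close>
      define K where "K w = (\<integral>\<^sup>+z. h (merge D (C - D) (w, z))
          * ennreal (g C (merge D (C - D) (w, z))) \<partial>leb (C - D))" for w
      have hg: "(\<lambda>u. h u * ennreal (g C u)) \<in> borel_measurable (leb C)" using h gC by simp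
      then have Km: "K \<in> borel_measurable (leb D)"
        unfolding K_def[abs_def] using borel_measurable_nn_integral_merge[of _ D "C - D"] DC finC
        by simp
      let ?H = "\<lambda>w. K w / ennreal (g D w)"
      have Hm: "?H \<in> borel_measurable (leb D)" using Km gD by simp
      have "(\<integral>\<^sup>+x. \<integral>\<^sup>+z. h (restrict (merge U (C - D) (x, z)) (Cs ! l)) *
           (ennreal (chain_density Cs g n x)
               * (ennreal (g C (?m x z)) / ennreal (g D (restrict x D)))) \<partial>leb (C - D) \<partial>leb U)
        = (\<integral>\<^sup>+x. ?H (restrict x D) * ennreal (chain_density Cs g n x) \<partial>leb U)"
      proof (rule nn_integral_cong)
        fix x assume x: "x \<in> space (leb U)"
        have CD: "C - D = C - U" by (auto simp: D)
        have "restrict (merge U (C - D) (x, z)) (Cs ! l) = ?m x z" for z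
          using restrict_merge_Diff[OF x, of C z] unfolding CD by (simp add: D C_def)
        then have "(\<integral>\<^sup>+z. h (restrict (merge U (C - D) (x, z)) (Cs ! l)) *
           (ennreal (chain_density Cs g n x)
               * (ennreal (g C (?m x z)) / ennreal (g D (restrict x D)))) \<partial>leb (C - D))
          = (\<integral>\<^sup>+z. (ennreal (chain_density Cs g n x) / ennreal (g D (restrict x D))) * (h (?m x z)
              * ennreal (g C (?m x z))) \<partial>leb (C - D))"
          by (intro nn_integral_cong) (simp add: divide_ennreal_def ac_simps)
        also have "\<dots> = ennreal (chain_density Cs g n x) / ennreal (g D (restrict x D))
            * K (restrict x D)"
          unfolding K_def
          by (rule nn_integral_cmult)
            (use measurable_leb_merge_Pair[of "\<lambda>u. h u
                * ennreal (g C u)" D "C - D", OF _ rD] hg DC in simp)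
        finally show "(\<integral>\<^sup>+z. h (restrict (merge U (C - D) (x, z)) (Cs ! l)) *
           (ennreal (chain_density Cs g n x)
               * (ennreal (g C (?m x z)) / ennreal (g D (restrict x D)))) \<partial>leb (C - D))
           = ?H (restrict x D) * ennreal (chain_density Cs g n x)"
          by (simp add: divide_ennreal_def ac_simps)
      qed
      also have "\<dots> = (\<integral>\<^sup>+x. ?H (restrict (restrict x (Cs ! k)) D)
          * ennreal (chain_density Cs g n x) \<partial>leb U)"
        using k(2) by (simp add: Int_absorb1)
      also have "\<dots> = (\<integral>\<^sup>+u. ?H (restrict u D) * ennreal (g (Cs ! k) u) \<partial>leb (Cs ! k))"
        unfolding U_def
        by (rule Suc.IH[OF k(1), of "\<lambda>u. ?H (restrict u D)"])
            (use n measurable_leb_restrict_comp[OF k(2) Hm] in auto)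
      also have "\<dots> = (\<integral>\<^sup>+w. ?H w * ennreal (g D w) \<partial>leb D)"
        using nn_integral_marginal[OF n Ck _ , of ?H] k(2) Hm unfolding D_def by simp
      also have "\<dots> = (\<integral>\<^sup>+w. K w \<partial>leb D)"
      proof (rule nn_integral_cong)
        fix w assume w: "w \<in> space (leb D)"
        show "?H w * ennreal (g D w) = K w"
        proof (cases "g D w = 0")
          case True
          have "K w = (\<integral>\<^sup>+z. 0 \<partial>leb (C - D))"
            unfolding K_def
          proof (rule nn_integral_cong)
            fix z assume z: "z \<in> space (leb (C - D))"
            have "w \<notin> pos_orthant D" using gDz[OF w] True by simp
            have "merge D (C - D) (w, z) \<notin> pos_orthant C"
            proof
              assume "merge D (C - D) (w, z) \<in> pos_orthant C"
              then have "restrict (merge D (C - D) (w, z)) D \<in> pos_orthant D"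
                by (rule pos_orthant_restrict) (simp add: D)
              moreover have "restrict (merge D (C - D) (w, z)) D = w"
                using w by (auto simp: space_leb fun_eq_iff PiE_def extensional_def)
              ultimately show False using \<open>w \<notin> pos_orthant D\<close> by simp
            qed
            moreover have "merge D (C - D) (w, z) \<in> space (leb C)"
              using w z by (auto simp: space_leb PiE_iff extensional_def merge_def D)
            ultimately have "g C (merge D (C - D) (w, z)) = 0"
              using marginal_familyD(4)[OF fam C] by blast
            then show "h (merge D (C - D) (w, z)) * ennreal (g C (merge D (C - D) (w, z))) = 0"
              by simp
          qed
          then show ?thesis by (simp add: True)
        next
          case False
          then have "0 < g D w" using gD0[OF w] by simp
          then show ?thesis by (simp add: ennreal_divide_times ennreal_divide_self)
        qed
      qed
      also have "\<dots> = (\<integral>\<^sup>+z. h z * ennreal (g C z) \<partial>leb C)"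
        unfolding K_def using nn_integral_leb_fold[of D "C - D" "\<lambda>u. h u
            * ennreal (g C u)"] finC DC hg finite_subset[of D C] D by simp
      finally show ?thesis unfolding split by (simp add: C_def)
    qed
  qed
qed

end

section \<open>The joint exponent density\<close>

lemma nonneg_orthant_sets: "finite I \<Longrightarrow> nonneg_orthant I \<in> sets (leb I)"
  unfolding nonneg_orthant_def by (rule sets_leb_PiE) auto

lemma pos_orthant_sets: "finite I \<Longrightarrow> pos_orthant I \<in> sets (leb I)"
  unfolding pos_orthant_def by (rule sets_leb_PiE) auto

lemma punctured_orthant_sets:
  assumes "finite I"
  shows "punctured_orthant I \<in> sets (leb I)"
proof -
  have "{\<lambda>i\<in>I. 0} = (\<Pi>\<^sub>E i\<in>I. {0::real})"
    by (auto simp: PiE_iff fun_eq_iff extensional_def)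
  then show ?thesis
    unfolding punctured_orthant_def
    using nonneg_orthant_sets[OF assms] sets_leb_PiE[OF assms, of "\<lambda>_. {0}"] by auto
qed

lemma pos_orthant_subset_punctured: "I \<noteq> {} \<Longrightarrow> pos_orthant I \<subseteq> punctured_orthant I"
  by (fastforce simp: pos_orthant_def punctured_orthant_def nonneg_orthant_def PiE_iff fun_eq_iff)

lemma pareto_space_eq:
  assumes "finite I" "I \<noteq> {}"
  shows "pareto_space I = {y \<in> punctured_orthant I. \<exists>i\<in>I. 1 < y i}"
  using assms
  by (auto simp: pareto_space_def Max_gr_iff punctured_orthant_def nonneg_orthant_def PiE_iff)

text \<open>Identifies the support of the Pareto law with the set whose mass is
  \<open>exponent_mass\<close>.\<close>

lemma pareto_space_eq_Diff_cube:
  assumes "finite I" "I \<noteq> {}"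
  shows "pareto_space I = punctured_orthant I - (\<Pi>\<^sub>E i\<in>I. {0..1})"
proof -
  have "(\<exists>i\<in>I. 1 < y i) \<longleftrightarrow> y \<notin> (\<Pi>\<^sub>E i\<in>I. {0..1})" if "y \<in> punctured_orthant I" for y
  proof -
    have "y \<in> (\<Pi>\<^sub>E i\<in>I. {0..})"
      using that by (simp add: punctured_orthant_def nonneg_orthant_def)
    then have "y \<in> (\<Pi>\<^sub>E i\<in>I. {0..1}) \<longleftrightarrow> (\<forall>i\<in>I. y i \<le> 1)"
      unfolding PiE_iff by simp
    then show ?thesis by (simp add: not_le)
  qed
  then show ?thesis unfolding pareto_space_eq[OF assms] by blast
qed

lemma pareto_space_sets:
  assumes "finite I" "I \<noteq> {}"
  shows "pareto_space I \<in> sets (leb I)"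
  unfolding pareto_space_eq_Diff_cube[OF assms]
  by (intro sets.Diff punctured_orthant_sets sets_leb_PiE assms) auto

lemma borel_measurable_indicator_gt_one:
  assumes "i \<in> I"
  shows "(indicator {y. 1 < y i} :: ('v \<Rightarrow> real) \<Rightarrow> ennreal) \<in> borel_measurable (leb I)"
proof -
  have "(\<lambda>y. indicator {1<..} (y i) :: ennreal) \<in> borel_measurable (leb I)"
    using assms by measurable
  moreover have "(\<lambda>y. indicator {1<..} (y i)) = (indicator {y. 1 < y i} :: ('v \<Rightarrow> real) \<Rightarrow> ennreal)"
    by (simp add: indicator_def fun_eq_iff)
  ultimately show ?thesis by simp
qed

lemma nonneg_orthant_cases:
  "y \<in> nonneg_orthant I \<Longrightarrow> y \<notin> punctured_orthant I \<Longrightarrow> y = (\<lambda>i\<in>I. 0)"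
  by (auto simp: punctured_orthant_def)

text \<open>The restriction of a non-zero vector may be the zero vector, outside the domain on which
  \<open>f\<close> is known to be measurable. This is a single point, so \<open>f\<close> can be
  replaced there by a constant.\<close>

lemma borel_measurable_restrict_punctured:
  assumes f: "f \<in> borel_measurable (restrict_space (leb J) (punctured_orthant J))"
    and I: "finite I" "J \<subseteq> I"
  shows "(\<lambda>y. f (restrict y J) :: real) \<in> borel_measurable (restrict_space (leb I)
      (punctured_orthant I))"
proof -
  have J: "finite J" using I finite_subset by auto
  let ?P = "punctured_orthant J"
  let ?f = "\<lambda>u. indicator ?P u *\<^sub>R f u + (1 - indicator ?P u) * f (\<lambda>i\<in>J. 0)"
  have "(\<lambda>u. indicator ?P u *\<^sub>R f u) \<in> borel_measurable (leb J)"
    using f punctured_orthant_sets[OF J] by (subst (asm) borel_measurable_restrict_space_iff) auto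
  then have "?f \<in> borel_measurable (leb J)"
    using punctured_orthant_sets[OF J] by (intro borel_measurable_add borel_measurable_times) auto
  then have m: "(\<lambda>y. ?f (restrict y J)) \<in> borel_measurable (restrict_space (leb I)
      (punctured_orthant I))"
    by (intro measurable_restrict_space1 measurable_leb_restrict_comp[OF I(2)])
  have "f (restrict y J) = ?f (restrict y J)" if "y \<in> punctured_orthant I" for y
  proof (cases "restrict y J \<in> ?P")
    case False
    have "restrict y J \<in> nonneg_orthant J"
      using that I(2) by (auto simp: punctured_orthant_def nonneg_orthant_def PiE_iff)
    from nonneg_orthant_cases[OF this False] False show ?thesis by simp
  qed simp
  with m show ?thesis
    by (subst measurable_cong[of _ _ "\<lambda>y. ?f (restrict y J)"]) (simp_all add: space_restrict_space)
qed

lemma pos_part_density_measurable: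
  assumes "finite I" "I \<noteq> {}" "f \<in> borel_measurable (restrict_space (leb I) (punctured_orthant I))"
  shows "pos_part_density I f \<in> borel_measurable (leb I)"
proof -
  have "(\<lambda>u. indicator (punctured_orthant I) u *\<^sub>R f u) \<in> borel_measurable (leb I)"
    using assms punctured_orthant_sets[OF assms(1)]
    by (subst (asm) borel_measurable_restrict_space_iff) auto
  then have "(\<lambda>u. indicator (pos_orthant I) u * (indicator (punctured_orthant I) u *\<^sub>R f u))
      \<in> borel_measurable (leb I)"
    using pos_orthant_sets[OF assms(1)] by (intro borel_measurable_times) auto
  moreover have "indicator (pos_orthant I) u * (indicator (punctured_orthant I) u *\<^sub>R f u)
      = pos_part_density I f u" for u
    using pos_orthant_subset_punctured[OF assms(2)]
    by (auto simp: pos_part_density_def indicator_def)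
  ultimately show ?thesis by simp
qed

lemma AE_pos_part_density:
  assumes "finite I" "I \<noteq> {}"
  shows "AE y in leb I. ennreal (f y) * indicator (punctured_orthant I) y
      = ennreal (pos_part_density I f y)"
  using AE_leb_nonneg_pos[OF assms(1)]
proof eventually_elim
  case (elim y)
  then show ?case
    using pos_orthant_subset_punctured[OF assms(2)]
    by (auto simp: pos_part_density_def indicator_def punctured_orthant_def)
qed

lemma nn_integral_punctured_orthant:
  assumes "finite I" "I \<noteq> {}"
  shows "(\<integral>\<^sup>+y \<in> {y \<in> punctured_orthant I. y \<in> A}. ennreal (f y) \<partial>leb I)
    = (\<integral>\<^sup>+y. indicator A y * ennreal (pos_part_density I f y) \<partial>leb I)"
  by (rule nn_integral_cong_AE, use AE_pos_part_density[OF assms, of f] in eventually_elim)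
     (auto simp: indicator_def split: if_splits)

text \<open>At positive \<open>y\<close> the faces in the \<open>z\<close> coordinates are null and
  the assumed consistency applies. At other \<open>y\<close> no merged vector is positive, and both
  sides are 0.\<close>

lemma nn_integral_marginal_pos_part:
  assumes "is_marginal_density D C g f" "finite C" "D \<subseteq> C" "y \<in> space (leb D)"
  shows "(\<integral>\<^sup>+z. ennreal (pos_part_density C f (merge D (C - D) (y, z))) \<partial>leb (C - D))
     = ennreal (pos_part_density D g y)"
proof -
  have merge: "merge D (C - D) (y, z) \<in> pos_orthant C \<longleftrightarrow> y \<in> pos_orthant D \<and> z \<in> pos_orthant (C - D)"
    if "z \<in> space (leb (C - D))" for z
  proof -
    have "D \<union> (C - D) = C" using assms by auto
    then show ?thesis using that assms(4) PiE_cancel_merge[of D "C - D" y z "\<lambda>_. {0<..}"]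
      unfolding pos_orthant_def by (auto simp: space_leb PiE_iff)
  qed
  show ?thesis
  proof (cases "y \<in> pos_orthant D")
    case True
    have "(\<integral>\<^sup>+z. ennreal (pos_part_density C f (merge D (C - D) (y, z))) \<partial>leb (C - D))
      = (\<integral>\<^sup>+z \<in> nonneg_orthant (C - D). ennreal (f (merge D (C - D) (y, z))) \<partial>leb (C - D))"
    proof (rule nn_integral_cong_AE)
      have "finite (C - D)" using assms by auto
      from AE_leb_nonneg_pos[OF this] AE_space
      show "AE z in leb (C - D). ennreal (pos_part_density C f (merge D (C - D) (y, z)))
          = ennreal (f (merge D (C - D) (y, z))) * indicator (nonneg_orthant (C - D)) z"
      proof eventually_elim
        case (elim z)
        have "pos_orthant (C - D) \<subseteq> nonneg_orthant (C - D)"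
          by (auto simp: pos_orthant_def nonneg_orthant_def PiE_iff intro: less_imp_le)
        with elim show ?case
          using merge[OF elim(2)] True by (auto simp: pos_part_density_def indicator_def)
      qed
    qed
    also have "\<dots> = ennreal (pos_part_density D g y)"
      using assms(1) True by (auto simp: is_marginal_density_def pos_part_density_def)
    finally show ?thesis .
  next
    case False
    then have "(\<integral>\<^sup>+z. ennreal (pos_part_density C f (merge D (C - D) (y, z))) \<partial>leb (C - D))
        = (\<integral>\<^sup>+z. 0 \<partial>leb (C - D))"
      by (intro nn_integral_cong) (simp add: pos_part_density_def merge)
    with False show ?thesis by (simp add: pos_part_density_def)
  qed
qed

section \<open>Cliques, separators and their cardinalities\<close>

text \<open>A single vertex is complete, and by finiteness it lies in a maximal complete
  subset.\<close>

lemma Union_cliques: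
  assumes "finite V"
  shows "\<Union>(cliques V E) = V"
proof
  show "\<Union>(cliques V E) \<subseteq> V" by (auto simp: cliques_def complete_subset_def)
  show "V \<subseteq> \<Union>(cliques V E)"
  proof
    fix v assume v: "v \<in> V"
    let ?S = "{S. complete_subset V E S}"
    have "?S \<subseteq> Pow V" by (auto simp: complete_subset_def)
    then have "finite ?S" using assms finite_subset by blast
    moreover have "{v} \<in> ?S" using v by (auto simp: complete_subset_def)
    ultimately obtain m where "m \<in> ?S" "{v} \<subseteq> m" "\<forall>b\<in>?S. m \<subseteq> b \<longrightarrow> m = b"
      using finite_has_maximal2[of ?S "{v}"] by blast
    then show "v \<in> \<Union>(cliques V E)" by (force simp: cliques_def)
  qed
qed

text \<open>Distinctness turns the product over the set of cliques into one over positions.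
  Separators may repeat, which the multiset product counts correctly.\<close>

lemma clique_density_eq_chain_density:
  assumes "distinct Cs"
  shows "clique_density (set Cs) (separators Cs) lam = chain_density Cs lam (length Cs)"
proof
  fix y
  have "(\<Prod>C\<in>set Cs. lam C (restrict y C)) = (\<Prod>l<length Cs. lam (Cs ! l) (restrict y (Cs ! l)))"
    by (rule prod.reindex_bij_betw[symmetric, OF bij_betw_nth[OF assms]]) auto
  moreover have "(\<Prod>D\<in>#separators Cs. lam D (restrict y D))
      = (\<Prod>l\<in>{1..<length Cs}. lam (separator_at Cs l) (restrict y (separator_at Cs l)))"
    unfolding separators_def mset_map[symmetric] prod_mset_prod_list map_map
    by (simp add: prod.distinct_set_conv_list[symmetric] comp_def del: One_nat_def)
  ultimately show "clique_density (set Cs) (separators Cs) lam y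
      = chain_density Cs lam (length Cs) y"
    by (simp add: clique_density_def chain_density_def)
qed

text \<open>Appending a clique satisfies \<open>|C| + |U| = |C \<union> U| + |D|\<close>. There is
  one clique more than there are separators, which leaves a single extra 1.\<close>

lemma sum_card_chain:
  assumes "\<And>C. C \<in> set Cs \<Longrightarrow> finite C" "1 \<le> n" "n \<le> length Cs"
  shows "(\<Sum>l<n. card (Cs ! l) + 1) = (\<Sum>l\<in>{1..<n}. card (separator_at Cs l) + 1) + (card
      (\<Union>j<n. Cs ! j) + 1)"
  using assms(2,3)
proof (induction n rule: nat_induct_at_least)
  case base
  have "(\<Union>j<1. Cs ! j) = Cs ! 0" by auto
  then show ?case by simp
next
  case (Suc n)
  let ?U = "\<Union>j<n. Cs ! j"
  have "finite (Cs ! n)" "finite ?U" using Suc.prems by (auto intro!: assms(1))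
  from card_Un_Int[OF this] have "card (Cs ! n) + card ?U
      = card (\<Union>j<Suc n. Cs ! j) + card (separator_at Cs n)"
    by (simp add: lessThan_Suc separator_at_def)
  moreover have "{1..<Suc n} = insert n {1..<n}" using Suc.hyps by auto
  ultimately show ?case using Suc by simp
qed

section \<open>Validity of the joint density\<close>

locale clique_densities =
  fixes V :: "'v set" and E :: "('v \<times> 'v) set" and Cs :: "'v set list"
    and lam :: "'v set \<Rightarrow> ('v \<Rightarrow> real) \<Rightarrow> real"
  assumes finite_V: "finite V" and V_nonempty: "V \<noteq> {}"
    and ordering: "clique_ordering V E Cs"
    and valid: "\<And>I. I \<in> cliques V E \<or> I \<in># separators Cs \<Longrightarrow> valid_exponent_density I (lam I)"
    and positive: "\<And>I. I \<in> cliques V E \<or> I \<in># separators Cs \<Longrightarrow> positive_density I (lam I)"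
    and marginal: "\<And>D C. D \<in># separators Cs \<Longrightarrow> C \<in> cliques V E \<Longrightarrow> D \<subseteq> C \<Longrightarrow>
           is_marginal_density D C (lam D) (lam C)"
begin

abbreviation "gam I \<equiv> pos_part_density I (lam I)"

definition "joint = clique_density (cliques V E) (separators Cs) lam"

lemma set_Cs: "set Cs = cliques V E" and distinct_Cs: "distinct Cs"
  and rip: "running_intersection Cs"
  using ordering by (auto simp: clique_ordering_def)

lemma separator_mem: "1 \<le> l \<Longrightarrow> l < length Cs \<Longrightarrow> separator_at Cs l \<in># separators Cs"
  by (auto simp: separators_def)

lemma Union_nth: "(\<Union>j<length Cs. Cs ! j) = V"
proof -
  have "(\<Union>j<length Cs. Cs ! j) = \<Union>(set Cs)" by (auto simp: set_conv_nth)
  then show ?thesis using Union_cliques[OF finite_V] set_Cs by simp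
qed

lemma length_pos: "1 \<le> length Cs"
  using Union_nth V_nonempty by (cases Cs) auto

lemma nth_subset: "l < length Cs \<Longrightarrow> Cs ! l \<subseteq> V"
  and separator_subset: "l < length Cs \<Longrightarrow> separator_at Cs l \<subseteq> V"
  using Union_nth by (auto simp: separator_at_def)

lemma valid_nth: "l < length Cs \<Longrightarrow> valid_exponent_density (Cs ! l) (lam (Cs ! l))"
  using valid set_Cs nth_mem by metis

lemma marginal_family_gam: "marginal_family Cs gam"
proof -
  have *: "finite I \<and> gam I \<in> borel_measurable (leb I) \<and>
       (\<forall>y\<in>space (leb I). 0 \<le> gam I y \<and> (gam I y \<noteq> 0 \<longleftrightarrow> y \<in> pos_orthant I))"
    if "I \<in> cliques V E \<or> I \<in># separators Cs" for I
  proof (intro conjI ballI)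
    show "finite I" "gam I \<in> borel_measurable (leb I)"
      using valid[OF that] pos_part_density_measurable by (auto simp: valid_exponent_density_def)
    fix y
    show "0 \<le> gam I y" "gam I y \<noteq> 0 \<longleftrightarrow> y \<in> pos_orthant I"
      using positive[OF that] by (force simp: positive_density_def pos_part_density_def
          indicator_def)+
  qed
  have "finite C" if "C \<in> cliques V E" for C using *[of C] that by blast
  then show ?thesis
    unfolding marginal_family_def Let_def
    using * set_Cs separator_mem nn_integral_marginal_pos_part[OF marginal]
    by (auto simp del: One_nat_def)
qed

lemma joint_eq: "joint = chain_density Cs lam (length Cs)"
  unfolding joint_def set_Cs[symmetric] by (rule clique_density_eq_chain_density[OF distinct_Cs])

text \<open>On the open orthant every restriction is positive and all cut-offs are inactive; off it
  the chain density vanishes with the left side.\<close>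

lemma pos_part_joint:
  assumes "y \<in> space (leb V)"
  shows "pos_part_density V joint y = chain_density Cs gam (length Cs) y"
proof (cases "y \<in> pos_orthant V")
  case True
  then show ?thesis
    unfolding joint_eq
    using pos_orthant_restrict[OF True nth_subset] pos_orthant_restrict[OF True separator_subset]
    by (simp add: pos_part_density_def chain_density_def)
next
  case False
  then show ?thesis
    using chain_density_nonzero[OF marginal_family_gam, of "length Cs" y] assms Union_nth
    by (auto simp: pos_part_density_def)
qed

lemma joint_nonneg: "y \<in> pos_orthant V \<Longrightarrow> 0 \<le> joint y"
  using chain_density_nonneg[OF marginal_family_gam order_refl, of y] pos_part_joint[of y]
  by (auto simp: pos_part_density_def pos_orthant_def space_leb PiE_iff)

lemma joint_measurable: "joint \<in> borel_measurable (restrict_space (leb V) (punctured_orthant V))"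
  unfolding joint_eq chain_density_def[abs_def]
proof (intro borel_measurable_divide borel_measurable_prod)
  fix l assume "l \<in> {..<length Cs}"
  then show "(\<lambda>y. lam (Cs ! l) (restrict y (Cs ! l)))
      \<in> borel_measurable (restrict_space (leb V) (punctured_orthant V))"
    using valid_nth[of l] nth_subset[of l]
    by (intro borel_measurable_restrict_punctured finite_V) (auto simp: valid_exponent_density_def)
next
  fix l assume "l \<in> {1..<length Cs}"
  then show "(\<lambda>y. lam (separator_at Cs l) (restrict y (separator_at Cs l)))
      \<in> borel_measurable (restrict_space (leb V) (punctured_orthant V))"
    using valid[OF disjI2[OF separator_mem[of l]]] separator_subset[of l]
    by (intro borel_measurable_restrict_punctured finite_V) (auto simp: valid_exponent_density_def)
qed

lemma joint_scale:
  assumes y: "y \<in> pos_orthant V" and t: "0 < t"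
  shows "joint (\<lambda>i\<in>V. t * y i) = joint y / t ^ (card V + 1)"
proof -
  have scale: "lam I (restrict (\<lambda>i\<in>V. t * y i) I) = lam I (restrict y I) / t ^ (card I + 1)"
    if I: "I \<in> cliques V E \<or> I \<in># separators Cs" "I \<subseteq> V" for I
  proof -
    have "restrict (\<lambda>i\<in>V. t * y i) I = (\<lambda>i\<in>I. t * restrict y I i)" using I(2)
      by (auto simp: fun_eq_iff)
    then show ?thesis
      using valid[OF I(1)] pos_orthant_restrict[OF y I(2)] t
      by (auto simp: valid_exponent_density_def)
  qed
  let ?a = "\<Sum>l<length Cs. card (Cs ! l) + 1"
    and ?b = "\<Sum>l\<in>{1..<length Cs}. card (separator_at Cs l) + 1"
  have num: "(\<Prod>l<length Cs. lam (Cs ! l) (restrict (\<lambda>i\<in>V. t * y i) (Cs ! l)))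
     = (\<Prod>l<length Cs. lam (Cs ! l) (restrict y (Cs ! l))) / t ^ ?a"
    unfolding power_sum prod_dividef[symmetric]
    by (intro prod.cong refl scale) (use set_Cs nth_subset in auto)
  have den: "(\<Prod>l\<in>{1..<length Cs}. lam (separator_at Cs l) (restrict (\<lambda>i\<in>V. t
      * y i) (separator_at Cs l)))
     = (\<Prod>l\<in>{1..<length Cs}. lam (separator_at Cs l) (restrict y (separator_at Cs l))) / t ^ ?b"
    unfolding power_sum prod_dividef[symmetric]
    by (intro prod.cong refl scale) (use separator_mem separator_subset in auto)
  have "finite C" if "C \<in> set Cs" for C using marginal_familyD(1)[OF marginal_family_gam that] .
  then have "?a = ?b + (card V + 1)"
    using sum_card_chain[OF _ length_pos order_refl] Union_nth by simp
  then have "t ^ ?a = t ^ ?b * t ^ (card V + 1)" by (simp only: power_add)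
  then show ?thesis
    unfolding joint_eq chain_density_def num den using t by (simp add: field_simps)
qed

text \<open>The event \<open>1 < y i\<close> depends only on the coordinates of a clique containing
  \<open>i\<close>, so its indicator serves as a test function for the marginal on that
  clique.\<close>

lemma nn_integral_pos_part_joint:
  assumes "i \<in> V"
  shows "(\<integral>\<^sup>+y. indicator {y. 1 < y i} y * ennreal (pos_part_density V joint y) \<partial>leb V) = 1"
proof -
  obtain l where l: "l < length Cs" "i \<in> Cs ! l" using assms Union_nth by auto
  have C: "finite (Cs ! l)" "Cs ! l \<noteq> {}" using valid_nth[OF l(1)]
    by (auto simp: valid_exponent_density_def)
  note m = borel_measurable_indicator_gt_one[OF l(2)]
  have "(\<integral>\<^sup>+y. indicator {y. 1 < y i} y * ennreal (pos_part_density V joint y) \<partial>leb V)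
    = (\<integral>\<^sup>+y. indicator {y. 1 < y i} (restrict y (Cs ! l))
        * ennreal (chain_density Cs gam (length Cs) y) \<partial>leb V)"
    using l(2) by (intro nn_integral_cong) (simp add: pos_part_joint indicator_def)
  also have "\<dots> = (\<integral>\<^sup>+z. indicator {y. 1 < y i} z * ennreal (gam (Cs ! l) z) \<partial>leb (Cs ! l))"
    using nn_integral_chain_density[OF marginal_family_gam rip l(1) order_refl m] Union_nth by simp
  also have "\<dots> = (\<integral>\<^sup>+z \<in> {z \<in> punctured_orthant (Cs ! l). 1 < z i}. ennreal (lam (Cs ! l) z) \<partial>leb
      (Cs ! l))"
    using nn_integral_punctured_orthant[OF C, of _ "{y. 1 < y i}"] by simp
  also have "\<dots> = 1"
    using valid_nth[OF l(1)] l(2) by (auto simp: valid_exponent_density_def)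
  finally show ?thesis .
qed

lemma valid_joint: "valid_exponent_density V joint"
  unfolding valid_exponent_density_def
proof (intro conjI ballI allI impI)
  fix i assume "i \<in> V"
  then show "(\<integral>\<^sup>+ y \<in> {y \<in> punctured_orthant V. y i > 1}. ennreal (joint y) \<partial>leb V) = 1"
    using nn_integral_punctured_orthant[OF finite_V V_nonempty, of joint "{y. 1 < y i}"]
      nn_integral_pos_part_joint[of i] by simp
qed (fact finite_V V_nonempty joint_measurable | rule joint_nonneg joint_scale; assumption)+

end

section \<open>Normalisation, the Pareto law and its conditioning\<close>

context clique_densities
begin

abbreviation "mass \<equiv> exponent_mass V joint"

abbreviation "Y_law \<equiv> law_with_density V (\<lambda>y. joint y / mass)"

text \<open>The Pareto space is the union of the events \<open>1 < y i\<close>, each of mass one.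
  Hence \<open>L\<close> lies between 1 and \<open>card V\<close>, and finiteness ensures that the
  real number \<open>mass\<close> represents it.\<close>

lemma emeasure_pareto_space:
  defines "L \<equiv> (\<integral>\<^sup>+y. indicator (pareto_space V) y * ennreal (pos_part_density V joint y) \<partial>leb V)"
  shows "L = ennreal mass" and "0 < mass"
proof -
  note fV = finite_V V_nonempty
  let ?g = "\<lambda>y. ennreal (pos_part_density V joint y)"
  have gm: "?g \<in> borel_measurable (leb V)"
    using pos_part_density_measurable[OF fV joint_measurable] by simp
  have ind: "(indicator {y. 1 < y i} :: _ \<Rightarrow> ennreal) \<in> borel_measurable (leb V)" if "i \<in> V" for i
    using borel_measurable_indicator_gt_one[OF that] .
  have PS: "pareto_space V \<in> sets (leb V)" by (rule pareto_space_sets[OF fV])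
  have "L \<le> (\<integral>\<^sup>+y. (\<Sum>i\<in>V. indicator {y. 1 < y i} y * ?g y) \<partial>leb V)"
    unfolding L_def
  proof (rule nn_integral_mono)
    fix y
    show "indicator (pareto_space V) y * ?g y \<le> (\<Sum>i\<in>V. indicator {y. 1 < y i} y * ?g y)"
    proof (cases "y \<in> pareto_space V")
      case True
      then obtain i where i: "i \<in> V" "1 < y i" unfolding pareto_space_eq[OF fV] by auto
      then have "indicator (pareto_space V) y * ?g y = indicator {y. 1 < y i} y * ?g y"
        using True by simp
      also have "\<dots> \<le> (\<Sum>i\<in>V. indicator {y. 1 < y i} y * ?g y)"
        by (rule member_le_sum) (use i finite_V in auto)
      finally show ?thesis .
    qed simp
  qed
  also have "\<dots> = (\<Sum>i\<in>V. \<integral>\<^sup>+y. indicator {y. 1 < y i} y * ?g y \<partial>leb V)"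
    using ind gm by (intro nn_integral_sum borel_measurable_times_ennreal) auto
  also have "\<dots> = of_nat (card V)" using nn_integral_pos_part_joint by simp
  finally have "L \<le> of_nat (card V)" .
  then have fin: "L < \<infinity>" using of_nat_less_top order_le_less_trans by fastforce
  obtain i where i: "i \<in> V" using V_nonempty by auto
  have "1 = (\<integral>\<^sup>+y. indicator {y. 1 < y i} y * ?g y \<partial>leb V)"
    using nn_integral_pos_part_joint[OF i] by simp
  also have "\<dots> \<le> L"
    unfolding L_def
  proof (rule nn_integral_mono)
    fix y
    show "indicator {y. 1 < y i} y * ?g y \<le> indicator (pareto_space V) y * ?g y"
      using pos_orthant_subset_punctured[OF V_nonempty] i
      by (auto simp: pareto_space_eq[OF fV] pos_part_density_def indicator_def)
  qed
  finally have ge: "1 \<le> L" .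
  have "emeasure (exponent_measure V joint) (pareto_space V)
     = (\<integral>\<^sup>+y. ennreal (joint y) * indicator (pareto_space V) y \<partial>restrict_space (leb V)
         (punctured_orthant V))"
    unfolding exponent_measure_def
    using joint_measurable PS punctured_orthant_sets[OF finite_V]
    by (intro emeasure_density) (auto simp: sets_restrict_space_iff pareto_space_def)
  also have "\<dots> = (\<integral>\<^sup>+y. ennreal (joint y) * indicator (pareto_space V) y
      * indicator (punctured_orthant V) y \<partial>leb V)"
    using punctured_orthant_sets[OF finite_V] by (intro nn_integral_restrict_space) auto
  also have "\<dots> = L"
    unfolding L_def
    by (rule nn_integral_cong_AE, use AE_pos_part_density[OF fV, of joint] in eventually_elim)
       (auto simp: indicator_def pareto_space_def split: if_splits)
  finally have "mass = enn2real L"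
    unfolding exponent_mass_def measure_def pareto_space_eq_Diff_cube[OF fV, symmetric] by simp
  then show "L = ennreal mass" using fin by simp
  with ge show "0 < mass" by (metis ennreal_eq_0_iff not_le not_one_le_zero)
qed

lemma Y_law_measurable: "(\<lambda>y. ennreal (joint y / mass))
    \<in> borel_measurable (restrict_space (leb V) (pareto_space V))"
proof -
  have "restrict_space (leb V) (pareto_space V)
      = restrict_space (restrict_space (leb V) (punctured_orthant V)) (pareto_space V)"
    using pareto_space_sets[OF finite_V V_nonempty] punctured_orthant_sets[OF finite_V]
    by (subst restrict_restrict_space) (auto simp: pareto_space_def Int_absorb1 Int_commute intro!:
        arg_cong2[where f=restrict_space])
  moreover have "(\<lambda>y. ennreal (joint y / mass))
      \<in> borel_measurable (restrict_space (leb V) (punctured_orthant V))"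
    using joint_measurable by simp
  ultimately show ?thesis using measurable_restrict_space1 by metis
qed

lemma sets_Y_law: "sets Y_law = sets (restrict_space (leb V) (pareto_space V))"
  by (simp add: law_with_density_def)

lemma measurable_Y_law: "h \<in> measurable (leb V) N \<Longrightarrow> h \<in> measurable Y_law N"
  using measurable_restrict_space1 measurable_cong_sets[OF sets_Y_law refl] by blast

text \<open>Moves integrals against the Pareto law to all of \<open>leb V\<close> with the cut-off
  density, where the mass formulas apply.\<close>

lemma nn_integral_Y_law:
  assumes h: "h \<in> borel_measurable (leb V)"
  shows "integral\<^sup>N Y_law h = (\<integral>\<^sup>+y. indicator (pareto_space V) y * h y
      * ennreal (pos_part_density V joint y) \<partial>leb V) / ennreal mass"
proof -
  note fV = finite_V V_nonempty
  have PS: "pareto_space V \<in> sets (leb V)" by (rule pareto_space_sets[OF fV])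
  have "integral\<^sup>N Y_law h = (\<integral>\<^sup>+y. ennreal (joint y / mass)
      * h y \<partial>restrict_space (leb V) (pareto_space V))"
    unfolding law_with_density_def using Y_law_measurable measurable_restrict_space1[OF h]
    by (rule nn_integral_density)
  also have "\<dots> = (\<integral>\<^sup>+y. ennreal (joint y / mass) * h y * indicator (pareto_space V) y \<partial>leb V)"
    using PS by (intro nn_integral_restrict_space) auto
  also have "\<dots> = (\<integral>\<^sup>+y. indicator (pareto_space V) y * h y
      * ennreal (pos_part_density V joint y) / ennreal mass \<partial>leb V)"
  proof (rule nn_integral_cong_AE, use AE_leb_nonneg_pos[OF finite_V] in eventually_elim)
    fix y assume y: "y \<in> nonneg_orthant V \<longrightarrow> y \<in> pos_orthant V"
    show "ennreal (joint y / mass) * h y * indicator (pareto_space V) y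
        = indicator (pareto_space V) y * h y * ennreal (pos_part_density V joint y) / ennreal mass"
    proof (cases "y \<in> pareto_space V")
      case True
      with y have "y \<in> pos_orthant V" by (auto simp: pareto_space_def punctured_orthant_def)
      then have "ennreal (joint y / mass) = ennreal (pos_part_density V joint y) / ennreal mass"
        using joint_nonneg emeasure_pareto_space(2)
        by (simp add: pos_part_density_def divide_ennreal)
      with True show ?thesis by (simp add: divide_ennreal_def ac_simps)
    qed simp
  qed
  also have "\<dots> = (\<integral>\<^sup>+y. indicator (pareto_space V) y * h y
      * ennreal (pos_part_density V joint y) \<partial>leb V) / ennreal mass"
    using pos_part_density_measurable[OF fV joint_measurable] h PS
    by (intro nn_integral_divide borel_measurable_times_ennreal) auto
  finally show ?thesis .
qed

lemma prob_space_Y_law: "prob_space Y_law"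
proof
  have "emeasure Y_law (space Y_law) = (\<integral>\<^sup>+y. 1 \<partial>Y_law)" by simp
  also have "\<dots> = 1"
    using emeasure_pareto_space by (subst nn_integral_Y_law) (simp_all add: ennreal_divide_self)
  finally show "emeasure Y_law (space Y_law) = 1" .
qed

lemma multivariate_pareto_Y_law: "multivariate_pareto V Y_law"
  unfolding multivariate_pareto_def using prob_space_Y_law valid_joint by blast

text \<open>The event \<open>1 < Y k\<close> has probability \<open>1 / mass\<close>, so the
  normalising constant cancels. The restriction to the Pareto space disappears too, since a positive
  vector with \<open>1 < y k\<close> belongs to it.\<close>

lemma nn_integral_conditioned:
  assumes k: "k \<in> V" and h: "h \<in> borel_measurable (leb V)"
  defines "S \<equiv> {y \<in> space Y_law. 1 < y k}"
  shows "integral\<^sup>N (uniform_measure Y_law S) h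
    = (\<integral>\<^sup>+y. h y * (indicator {y. 1 < y k} y * ennreal (pos_part_density V joint y)) \<partial>leb V)"
    and "prob_space (uniform_measure Y_law S)"
proof -
  note ind = borel_measurable_indicator_gt_one[OF k]
  let ?g = "\<lambda>y. ennreal (pos_part_density V joint y)"
  have pareto: "indicator (pareto_space V) y * (u * indicator {y. 1 < y k} y) * ?g y
      = u * (indicator {y. 1 < y k} y * ?g y)" for y u
    using pos_orthant_subset_punctured[OF V_nonempty] k
    by (auto simp: pareto_space_eq[OF finite_V V_nonempty] pos_part_density_def indicator_def)
  have S: "S \<in> sets Y_law"
    unfolding S_def using measurable_Y_law[OF measurable_leb_component[OF k]] by measurable
  have intS: "(\<integral>\<^sup>+y. u y * indicator S y \<partial>Y_law)
     = (\<integral>\<^sup>+y. u y * (indicator {y. 1 < y k} y * ?g y) \<partial>leb V) / ennreal mass"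
    if u: "u \<in> borel_measurable (leb V)" for u
  proof -
    have "(\<integral>\<^sup>+y. u y * indicator S y \<partial>Y_law) = (\<integral>\<^sup>+y. u y * indicator {y. 1 < y k} y \<partial>Y_law)"
      by (rule nn_integral_cong) (simp add: S_def indicator_def)
    also have "\<dots> = (\<integral>\<^sup>+y. indicator (pareto_space V) y * (u y * indicator {y. 1 < y k} y)
        * ?g y \<partial>leb V) / ennreal mass"
      by (rule nn_integral_Y_law) (use u ind in auto)
    finally show ?thesis unfolding pareto .
  qed
  have eS: "emeasure Y_law S = 1 / ennreal mass"
    using intS[of "\<lambda>_. 1"] nn_integral_pos_part_joint[OF k] S by simp
  have "emeasure Y_law S \<noteq> 0" "emeasure Y_law S \<noteq> \<infinity>"
    using emeasure_pareto_space(2) by (auto simp: eS divide_ennreal_def ennreal_inverse_eq_top_iff)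
  then show "prob_space (uniform_measure Y_law S)" by (rule prob_space_uniform_measure)
  have "integral\<^sup>N (uniform_measure Y_law S) h
      = (\<integral>\<^sup>+y. h y * indicator S y \<partial>Y_law) / emeasure Y_law S"
    using measurable_Y_law[OF h] S by (rule nn_integral_uniform_measure)
  also have "\<dots> = (\<integral>\<^sup>+y. h y * (indicator {y. 1 < y k} y
      * ?g y) \<partial>leb V) / ennreal mass / (1 / ennreal mass)"
    by (simp only: intS[OF h] eS)
  also have "x / ennreal mass / (1 / ennreal mass) = x" for x
  proof -
    have "inverse (ennreal mass) * inverse (inverse (ennreal mass)) = 1"
      using emeasure_pareto_space(2) by (simp add: inverse_ennreal ennreal_mult[symmetric])
    then show ?thesis by (simp only: divide_ennreal_def mult.assoc mult_1 mult_1_right)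
  qed
  finally show "integral\<^sup>N (uniform_measure Y_law S) h
    = (\<integral>\<^sup>+y. h y * (indicator {y. 1 < y k} y * ?g y) \<partial>leb V)" .
qed

section \<open>Factorisation for non-adjacent vertices and the Markov property\<close>

text \<open>\<open>a\<close> gathers the cliques and separators that contain \<open>i\<close>, and
  \<open>b\<close> gathers the others. The first avoid \<open>j\<close>, the second avoid
  \<open>i\<close>.\<close>

lemma pos_part_joint_factorization:
  assumes ij: "i \<noteq> j" "\<not> (\<exists>C\<in>cliques V E. i \<in> C \<and> j \<in> C)"
  obtains a b :: "('v \<Rightarrow> real) \<Rightarrow> real"
  where "a \<in> borel_measurable (leb V)" "b \<in> borel_measurable (leb V)"
    "\<And>y t. a (y(j := t)) = a y" "\<And>y t. b (y(i := t)) = b y" "\<And>y. 0 \<le> a y" "\<And>y. 0 \<le> b y"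
    "\<And>y. y \<in> space (leb V) \<Longrightarrow> pos_part_density V joint y = a y * b y"
proof -
  define p where "p Q y = (\<Prod>l<length Cs. if Q (Cs ! l) then gam (Cs ! l) (restrict y
      (Cs ! l)) else 1) /
     (\<Prod>l\<in>{1..<length Cs}. if Q (separator_at Cs l) then gam (separator_at Cs l) (restrict y
         (separator_at Cs l)) else 1)"
    for Q :: "'v set \<Rightarrow> bool" and y
  have meas: "p Q \<in> borel_measurable (leb V)" for Q
    unfolding p_def[abs_def]
  proof (intro borel_measurable_divide borel_measurable_prod)
    fix l assume "l \<in> {..<length Cs}"
    then show "(\<lambda>y. if Q (Cs ! l) then gam (Cs ! l) (restrict y (Cs ! l)) else 1)
        \<in> borel_measurable (leb V)"
      using measurable_leb_restrict_comp[OF nth_subset marginal_familyD(2)[OF marginal_family_gam]]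
      by (cases "Q (Cs ! l)") auto
  next
    fix l assume "l \<in> {1..<length Cs}"
    then show "(\<lambda>y. if Q (separator_at Cs l) then gam (separator_at Cs l) (restrict y
        (separator_at Cs l)) else 1)
       \<in> borel_measurable (leb V)"
      using measurable_leb_restrict_comp[OF separator_subset marginal_familyD(5)[OF
          marginal_family_gam]] by (cases "Q (separator_at Cs l)") auto
  qed
  have nonneg: "0 \<le> p Q y" for Q y
    unfolding p_def
    using marginal_familyD(3,6)[OF marginal_family_gam]
    by (intro divide_nonneg_nonneg prod_nonneg) (auto simp: space_leb)
  have indep: "p Q (y(k := t)) = p Q y"
    if "\<And>l. l < length Cs \<Longrightarrow> Q (Cs ! l) \<Longrightarrow> k \<notin> Cs ! l"
      and "\<And>l. l < length Cs \<Longrightarrow> Q (separator_at Cs l) \<Longrightarrow> k \<notin> separator_at Cs l" for Q y k t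
    unfolding p_def using that by (intro arg_cong2[where f="(/)"] prod.cong) auto
  have prod_split: "(\<Prod>x\<in>A. f x) = (\<Prod>x\<in>A. if R x then f x else 1) * (\<Prod>x\<in>A. if \<not> R x then f x else 1)"
    for A :: "nat set" and f :: "nat \<Rightarrow> real" and R
    unfolding prod.distrib[symmetric] by (rule prod.cong) auto
  have factor: "pos_part_density V joint y = p (\<lambda>I. i \<in> I) y * p (\<lambda>I. \<not> i \<in> I) y"
      if "y \<in> space (leb V)" for y
    unfolding pos_part_joint[OF that] chain_density_def p_def
      prod_split[of "\<lambda>l. gam (Cs ! l) (restrict y (Cs ! l))" _ "\<lambda>l. i \<in> Cs ! l"]
      prod_split[of "\<lambda>l. gam (separator_at Cs l) (restrict y (separator_at Cs l))" _ "\<lambda>l. i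
          \<in> separator_at Cs l"]
    by simp
  \<comment> \<open>Checking the cliques is enough, since each separator is contained in the clique
    at its own position.\<close>
  have no_j: "j \<notin> Cs ! l" if "l < length Cs" "i \<in> Cs ! l" for l
    using ij(2) that set_Cs nth_mem by blast
  have indep_j: "p (\<lambda>I. i \<in> I) (y(j := t)) = p (\<lambda>I. i \<in> I) y" for y t
    by (rule indep) (use no_j in \<open>auto simp: separator_at_def\<close>)
  have indep_i: "p (\<lambda>I. \<not> i \<in> I) (y(i := t)) = p (\<lambda>I. \<not> i \<in> I) y" for y t
    by (rule indep) auto
  show thesis
    by (rule that[OF meas meas indep_j indep_i nonneg nonneg factor])
qed

lemma pairwise_markov_Y_law: "pairwise_markov V E Y_law"
  unfolding pairwise_markov_def extremal_cond_indep_def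
proof (intro ballI impI)
  fix i j k assume i: "i \<in> V" and j: "j \<in> V" and k: "k \<in> V" and "i \<noteq> j \<and> (i, j) \<notin> E"
  \<comment> \<open>Two distinct vertices of one clique are adjacent.\<close>
  then have ij: "i \<noteq> j" "\<not> (\<exists>C\<in>cliques V E. i \<in> C \<and> j \<in> C)"
    by (auto simp: cliques_def complete_subset_def)
  from pos_part_joint_factorization[OF ij] obtain a b :: "('v \<Rightarrow> real) \<Rightarrow> real"
    where m: "a \<in> borel_measurable (leb V)" "b \<in> borel_measurable (leb V)"
      and indep: "\<And>y t. a (y(j := t)) = a y" "\<And>y t. b (y(i := t)) = b y"
      and nonneg: "\<And>y. 0 \<le> a y" "\<And>y. 0 \<le> b y"
      and ab: "\<And>y. y \<in> space (leb V) \<Longrightarrow> pos_part_density V joint y = a y * b y"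
    by metis
  \<comment> \<open>The conditioning indicator depends on \<open>y k\<close> alone. It must go into
    \<open>F\<close> when \<open>k = i\<close>, as \<open>G\<close> has to be free of
    \<open>y i\<close>; for every other \<open>k\<close>, including \<open>j\<close>, it may go into
    \<open>G\<close>.\<close>
  define F where "F y = ennreal (a y) * (if k = i then indicator {y. 1 < y k} y else 1)" for y
  define G where "G y = ennreal (b y) * (if k = i then 1 else indicator {y. 1 < y k} y)" for y
  note ind = borel_measurable_indicator_gt_one[OF k]
  show "cond_indep_var (uniform_measure Y_law {y \<in> space Y_law. 1 < y k})
     (\<Pi>\<^sub>M i\<in>{i}. borel) (\<lambda>y. restrict y {i}) (\<Pi>\<^sub>M i\<in>{j}. borel) (\<lambda>y. restrict y {j})
     (\<Pi>\<^sub>M i\<in>V - {i, j}. borel) (\<lambda>y. restrict y (V - {i, j}))"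
  proof (rule cond_indep_var_of_factorization[where F = F and G = G, OF finite_V i j ij(1)])
    show "F \<in> borel_measurable (leb V)" "G \<in> borel_measurable (leb V)"
      unfolding F_def[abs_def] G_def[abs_def] using m ind
      by (auto intro!: borel_measurable_times_ennreal)
    show "F (y(j := t)) = F y" "G (y(i := t)) = G y" for y t
      using indep ij(1) by (auto simp: F_def G_def indicator_def)
    show "prob_space (uniform_measure Y_law {y \<in> space Y_law. 1 < y k})"
      by (rule nn_integral_conditioned(2)[OF k, of "\<lambda>_. 1"]) simp
    show "pareto_space V \<in> sets (leb V)" by (rule pareto_space_sets[OF finite_V V_nonempty])
    show "sets (uniform_measure Y_law {y \<in> space Y_law. 1 < y k})
        = sets (restrict_space (leb V) (pareto_space V))"
      by (simp add: sets_Y_law)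
    fix h :: "('v \<Rightarrow> real) \<Rightarrow> ennreal" assume h: "h \<in> borel_measurable (leb V)"
    show "integral\<^sup>N (uniform_measure Y_law {y \<in> space Y_law. 1 < y k}) h
        = (\<integral>\<^sup>+y. h y * (F y * G y) \<partial>leb V)"
      unfolding nn_integral_conditioned(1)[OF k h]
      by (rule nn_integral_cong) (simp add: F_def G_def ab ennreal_mult nonneg ac_simps)
  qed
qed

end

theorem corollary1:
  fixes d :: nat
    and E :: "(nat \<times> nat) set"
    and Cs :: "nat set list"
    and lam :: "nat set \<Rightarrow> (nat \<Rightarrow> real) \<Rightarrow> real"
    and joint :: "(nat \<Rightarrow> real) \<Rightarrow> real"
    and P :: "(nat \<Rightarrow> real) measure"
  assumes "2 \<le> d"
    and "simple_graph {1..d} E"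
    and "connected_graph {1..d} E"
    and "chordal E"
    and "clique_ordering {1..d} E Cs"
    and "\<And>I. I \<in> cliques {1..d} E \<or> I \<in># separators Cs \<Longrightarrow>
           valid_exponent_density I (lam I) \<and> positive_density I (lam I) \<and> continuous_density I (lam I)"
    and "\<And>D C. D \<in># separators Cs \<Longrightarrow> C \<in> cliques {1..d} E \<Longrightarrow> D \<subseteq> C \<Longrightarrow>
           is_marginal_density D C (lam D) (lam C)"
  defines "joint \<equiv> clique_density (cliques {1..d} E) (separators Cs) lam"
  defines "P \<equiv> law_with_density {1..d} (\<lambda>y. joint y / exponent_mass {1..d} joint)"
  shows "valid_exponent_density {1..d} joint \<and>
         multivariate_pareto {1..d} P \<and>
         pairwise_markov {1..d} E P"
proof -
  interpret c: clique_densities "{1..d}" E Cs lam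
    using assms(1,5-7) by unfold_locales auto
  have "c.joint = joint"
    unfolding c.joint_def joint_def ..
  then show ?thesis
    using c.valid_joint c.multivariate_pareto_Y_law c.pairwise_markov_Y_law
    unfolding P_def by simp
qed

end
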